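(* There is an algorithm which, given as input integers $r\ge 2$, $d\ge 2$ and a word $w\in F(x_1,\dots,x_r)$, decides whether $w=1$ in the free solvable group $S_{r,d}$, in time $O(d\,r\,|w|^3)$. The algorithm is uniform in $r$ and $d$, and the constant in the bound does not depend on $r$, $d$ or $w$.
   Context: $F=F(x_1,\dots,x_r)$ is the free group of rank $r$; $F^{(1)}=[F,F]$, $F^{(d)}=[F^{(d-1)},F^{(d-1)}]$ for $d\ge2$; $S_{r,d}=F/F^{(d)}$ is the free solvable group of rank $r$ and class $d$. $|w|$ is the length of the word $w$. Time is the number of elementary steps performed, where operations on indices into $\{0,\dots,|w|\}$ (lookup, comparison) and on small integers are counted as single steps. *)

theory Defs
  imports "HOL-Algebra.Solvable_Groups"
begin

section \<open>Free groups and free solvable groups\<close>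

text \<open>The letter \<open>(i, True)\<close> stands for \<open>x\<^sub>i\<close>, the letter \<open>(i, False)\<close> for its inverse.\<close>

type_synonym letter = "nat \<times> bool"
type_synonym word = "letter list"

definition inv_letter :: "letter \<Rightarrow> letter" where
  "inv_letter x = (fst x, \<not> snd x)"

text \<open>All words over the generators \<open>x\<^sub>1, \<dots>, x\<^sub>r\<close> and their inverses, freely reduced or not.\<close>

definition words :: "nat \<Rightarrow> word set" where
  "words r = {w. \<forall>x \<in> set w. 1 \<le> fst x \<and> fst x \<le> r}"

definition reduced :: "word \<Rightarrow> bool" where
  "reduced w \<longleftrightarrow> successively (\<lambda>x y. y \<noteq> inv_letter x) w"

fun red_Cons :: "letter \<Rightarrow> word \<Rightarrow> word" where
  "red_Cons x [] = [x]"
| "red_Cons x (y # ys) = (if y = inv_letter x then ys else x # y # ys)"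

definition reduce :: "word \<Rightarrow> word" where
  "reduce w = foldr red_Cons w []"

definition free_group :: "nat \<Rightarrow> word monoid" where
  "free_group r =
     \<lparr>carrier = {w \<in> words r. reduced w}, mult = (\<lambda>u v. reduce (u @ v)), one = []\<rparr>"

definition derived_term :: "nat \<Rightarrow> nat \<Rightarrow> word set" where
  "derived_term r d = (derived (free_group r) ^^ d) (carrier (free_group r))"

definition free_solvable_group :: "nat \<Rightarrow> nat \<Rightarrow> word set monoid" where
  "free_solvable_group r d = free_group r Mod derived_term r d"

text \<open>The element of the free solvable group that is represented by a word.\<close>

definition word_class :: "nat \<Rightarrow> nat \<Rightarrow> word \<Rightarrow> word set" where
  "word_class r d w = derived_term r d #>\<^bsub>free_group r\<^esub> reduce w"

lemma inv_letter_inv [simp]: "inv_letter (inv_letter x) = x"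
  by (simp add: inv_letter_def)

lemma inv_letter_neq [simp]: "inv_letter x \<noteq> x" "x \<noteq> inv_letter x"
  by (simp_all add: inv_letter_def prod_eq_iff)

lemma reduced_red_Cons: "reduced w \<Longrightarrow> reduced (red_Cons x w)"
  by (cases w) (auto simp: reduced_def successively_Cons)

lemma red_Cons_inv: "reduced w \<Longrightarrow> red_Cons x (red_Cons (inv_letter x) w) = w"
proof (induction w rule: remdups_adj.induct)
  case (2 y)
  then show ?case by (cases "y = x") auto
next
  case (3 y z w)
  then have "z \<noteq> inv_letter y" by (simp add: reduced_def)
  then show ?case by (cases "y = x") auto
qed simp

lemma reduced_foldr: "reduced w \<Longrightarrow> reduced (foldr red_Cons u w)"
  by (induction u) (auto intro: reduced_red_Cons)

lemma reduced_reduce: "reduced (reduce w)"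
  unfolding reduce_def by (rule reduced_foldr) (simp add: reduced_def)

lemma reduce_reduced: "reduced w \<Longrightarrow> reduce w = w"
proof (induction w)
  case (Cons x w)
  then have "reduced w" by (auto simp: reduced_def successively_Cons)
  with Cons have "reduce (x # w) = red_Cons x w" by (simp add: reduce_def)
  also have "\<dots> = x # w" using Cons.prems by (cases w) (auto simp: reduced_def)
  finally show ?case .
qed (simp add: reduce_def)

lemma foldr_red_Cons_red:
  assumes "reduced w"
  shows "foldr red_Cons (red_Cons x v) w = red_Cons x (foldr red_Cons v w)"
proof (cases v)
  case (Cons y ys)
  have "red_Cons x (red_Cons (inv_letter x) (foldr red_Cons ys w)) = foldr red_Cons ys w"
    by (rule red_Cons_inv) (rule reduced_foldr[OF assms])
  then show ?thesis by (simp add: Cons)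
qed simp

lemma foldr_reduce: "reduced w \<Longrightarrow> foldr red_Cons (reduce u) w = foldr red_Cons u w"
proof (induction u)
  case (Cons x u)
  then show ?case
    using foldr_red_Cons_red[of w x "reduce u"] by (simp add: reduce_def)
qed (simp add: reduce_def)

lemma reduce_append: "reduce (u @ v) = foldr red_Cons u (reduce v)"
  by (simp add: reduce_def)

lemma reduce_append_reduce:
  "reduce (reduce u @ v) = reduce (u @ v)" "reduce (u @ reduce v) = reduce (u @ v)"
  by (simp_all add: reduce_append foldr_reduce reduced_reduce reduce_reduced)

lemma words_red_Cons: "[x] \<in> words r \<Longrightarrow> w \<in> words r \<Longrightarrow> red_Cons x w \<in> words r"
  by (cases w) (simp_all add: words_def)

lemma words_reduce: "w \<in> words r \<Longrightarrow> reduce w \<in> words r"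
proof (induction w)
  case (Cons x w)
  from Cons.prems have x: "[x] \<in> words r" and w: "w \<in> words r"
    by (simp_all add: words_def)
  have "red_Cons x (reduce w) \<in> words r"
    by (rule words_red_Cons[OF x Cons.IH[OF w]])
  then show ?case by (simp add: reduce_def)
qed (simp add: reduce_def)

lemma reduce_inverse: "reduce (map inv_letter (rev w) @ w) = []"
proof (induction w)
  case (Cons x w)
  have "reduce (map inv_letter (rev (x # w)) @ x # w)
      = foldr red_Cons (map inv_letter (rev w))
          (red_Cons (inv_letter x) (red_Cons (inv_letter (inv_letter x)) (reduce w)))"
    by (simp add: reduce_def)
  also have "\<dots> = reduce (map inv_letter (rev w) @ w)"
    by (simp only: red_Cons_inv[OF reduced_reduce] reduce_append)
  finally show ?case using Cons by simp
qed (simp add: reduce_def)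

lemma words_append: "u \<in> words r \<Longrightarrow> v \<in> words r \<Longrightarrow> u @ v \<in> words r"
  unfolding words_def by fastforce

lemma words_inverse: "u \<in> words r \<Longrightarrow> map inv_letter (rev u) \<in> words r"
  unfolding words_def inv_letter_def by fastforce

lemma group_free_group: "group (free_group r)"
proof (rule groupI)
  show "\<one>\<^bsub>free_group r\<^esub> \<in> carrier (free_group r)"
    by (simp add: free_group_def words_def reduced_def)
next
  fix u v
  assume "u \<in> carrier (free_group r)" "v \<in> carrier (free_group r)"
  then show "u \<otimes>\<^bsub>free_group r\<^esub> v \<in> carrier (free_group r)"
    by (simp add: free_group_def reduced_reduce words_reduce words_append)
next
  fix u v w
  show "u \<otimes>\<^bsub>free_group r\<^esub> v \<otimes>\<^bsub>free_group r\<^esub> w = u \<otimes>\<^bsub>free_group r\<^esub> (v \<otimes>\<^bsub>free_group r\<^esub> w)"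
    by (simp add: free_group_def reduce_append_reduce)
next
  fix u
  assume u: "u \<in> carrier (free_group r)"
  then show "\<one>\<^bsub>free_group r\<^esub> \<otimes>\<^bsub>free_group r\<^esub> u = u"
    by (simp add: free_group_def reduce_reduced)
  let ?v = "reduce (map inv_letter (rev u))"
  have "?v \<in> carrier (free_group r)"
    using u by (simp add: free_group_def words_reduce words_inverse reduced_reduce)
  moreover have "?v \<otimes>\<^bsub>free_group r\<^esub> u = \<one>\<^bsub>free_group r\<^esub>"
    by (simp add: free_group_def reduce_append_reduce reduce_inverse)
  ultimately show "\<exists>y \<in> carrier (free_group r). y \<otimes>\<^bsub>free_group r\<^esub> u = \<one>\<^bsub>free_group r\<^esub>"
    by blast
qed


section \<open>Algorithms and their running time\<close>

text \<open>
  Algorithms are programs of an imperative language with finitely many integer variables and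
  integer arrays per program. Elementary steps are: reading a constant or a variable, array
  lookup, addition, subtraction, comparison, a Boolean connective, assignment to a variable or an
  array cell, and a branching decision; each costs 1. There is no multiplication.

  The semantics has a bound \<open>B\<close> as parameter: a run gets stuck as soon as it evaluates an
  expression whose absolute value exceeds \<open>B\<close>, or uses a negative array index. So unit cost is
  charged only for operations on small integers, and large integers cannot be used to do the work
  of many steps in one.
\<close>

datatype aexp = N int | V string | Lookup string aexp | Plus aexp aexp | Minus aexp aexp

datatype bexp = Less aexp aexp | Equal aexp aexp | Neg bexp | Conj bexp bexp

datatype com =
    Skip
  | Assign string aexp
  | Update string aexp aexp
  | Seq com com
  | Cond bexp com com
  | While bexp com

record store =
  vars :: "string \<Rightarrow> int"
  arrays :: "string \<Rightarrow> int \<Rightarrow> int"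

fun aval :: "aexp \<Rightarrow> store \<Rightarrow> int" where
  "aval (N k) s = k"
| "aval (V x) s = vars s x"
| "aval (Lookup A a) s = arrays s A (aval a s)"
| "aval (Plus a b) s = aval a s + aval b s"
| "aval (Minus a b) s = aval a s - aval b s"

fun bval :: "bexp \<Rightarrow> store \<Rightarrow> bool" where
  "bval (Less a b) s \<longleftrightarrow> aval a s < aval b s"
| "bval (Equal a b) s \<longleftrightarrow> aval a s = aval b s"
| "bval (Neg p) s \<longleftrightarrow> \<not> bval p s"
| "bval (Conj p q) s \<longleftrightarrow> bval p s \<and> bval q s"

fun asafe :: "int \<Rightarrow> aexp \<Rightarrow> store \<Rightarrow> bool" where
  "asafe B (N k) s \<longleftrightarrow> \<bar>k\<bar> \<le> B"
| "asafe B (V x) s \<longleftrightarrow> \<bar>vars s x\<bar> \<le> B"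
| "asafe B (Lookup A a) s \<longleftrightarrow>
     asafe B a s \<and> 0 \<le> aval a s \<and> \<bar>aval (Lookup A a) s\<bar> \<le> B"
| "asafe B (Plus a b) s \<longleftrightarrow> asafe B a s \<and> asafe B b s \<and> \<bar>aval (Plus a b) s\<bar> \<le> B"
| "asafe B (Minus a b) s \<longleftrightarrow> asafe B a s \<and> asafe B b s \<and> \<bar>aval (Minus a b) s\<bar> \<le> B"

fun bsafe :: "int \<Rightarrow> bexp \<Rightarrow> store \<Rightarrow> bool" where
  "bsafe B (Less a b) s \<longleftrightarrow> asafe B a s \<and> asafe B b s"
| "bsafe B (Equal a b) s \<longleftrightarrow> asafe B a s \<and> asafe B b s"
| "bsafe B (Neg p) s \<longleftrightarrow> bsafe B p s"
| "bsafe B (Conj p q) s \<longleftrightarrow> bsafe B p s \<and> bsafe B q s"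

fun acost :: "aexp \<Rightarrow> nat" where
  "acost (N k) = 1"
| "acost (V x) = 1"
| "acost (Lookup A a) = acost a + 1"
| "acost (Plus a b) = acost a + acost b + 1"
| "acost (Minus a b) = acost a + acost b + 1"

fun bcost :: "bexp \<Rightarrow> nat" where
  "bcost (Less a b) = acost a + acost b + 1"
| "bcost (Equal a b) = acost a + acost b + 1"
| "bcost (Neg p) = bcost p + 1"
| "bcost (Conj p q) = bcost p + bcost q + 1"

text \<open>\<open>exec B c s t s'\<close>: within the bound \<open>B\<close>, the program \<open>c\<close> started in \<open>s\<close> halts in \<open>s'\<close> after
  \<open>t\<close> elementary steps.\<close>

inductive exec :: "int \<Rightarrow> com \<Rightarrow> store \<Rightarrow> nat \<Rightarrow> store \<Rightarrow> bool" for B where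
  Skip: "exec B Skip s 1 s"
| Assign: "asafe B a s \<Longrightarrow>
    exec B (Assign x a) s (acost a + 1) (s\<lparr>vars := (vars s)(x := aval a s)\<rparr>)"
| Update: "asafe B a s \<Longrightarrow> 0 \<le> aval a s \<Longrightarrow> asafe B b s \<Longrightarrow>
    exec B (Update A a b) s (acost a + acost b + 1)
      (s\<lparr>arrays := (arrays s)(A := (arrays s A)(aval a s := aval b s))\<rparr>)"
| Seq: "exec B c1 s t1 s1 \<Longrightarrow> exec B c2 s1 t2 s2 \<Longrightarrow> exec B (Seq c1 c2) s (t1 + t2) s2"
| CondTrue: "bsafe B p s \<Longrightarrow> bval p s \<Longrightarrow> exec B c1 s t s' \<Longrightarrow>
    exec B (Cond p c1 c2) s (bcost p + 1 + t) s'"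
| CondFalse: "bsafe B p s \<Longrightarrow> \<not> bval p s \<Longrightarrow> exec B c2 s t s' \<Longrightarrow>
    exec B (Cond p c1 c2) s (bcost p + 1 + t) s'"
| WhileFalse: "bsafe B p s \<Longrightarrow> \<not> bval p s \<Longrightarrow> exec B (While p c) s (bcost p + 1) s"
| WhileTrue: "bsafe B p s \<Longrightarrow> bval p s \<Longrightarrow> exec B c s t1 s1 \<Longrightarrow> exec B (While p c) s1 t2 s2 \<Longrightarrow>
    exec B (While p c) s (bcost p + 1 + t1 + t2) s2"

inductive_cases exec_SkipE: "exec B Skip s t s'"
inductive_cases exec_AssignE: "exec B (Assign x a) s t s'"
inductive_cases exec_UpdateE: "exec B (Update A a b) s t s'"
inductive_cases exec_SeqE: "exec B (Seq c1 c2) s t s'"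
inductive_cases exec_CondE: "exec B (Cond p c1 c2) s t s'"
inductive_cases exec_WhileE: "exec B (While p c) s t s'"

lemma exec_deterministic:
  "exec B c s t s' \<Longrightarrow> exec B c s u s'' \<Longrightarrow> u = t \<and> s'' = s'"
proof (induction arbitrary: u s'' rule: exec.induct)
  case (Skip s)
  from Skip.prems show ?case by (rule exec_SkipE) simp
next
  case (Assign a s x)
  from Assign.prems show ?case by (rule exec_AssignE) simp
next
  case (Update a s b A)
  from Update.prems show ?case by (rule exec_UpdateE) simp
next
  case (Seq c1 s t1 s1 c2 t2 s2)
  from Seq.prems show ?case
  proof (rule exec_SeqE)
    fix u1 s1' u2
    assume u: "u = u1 + u2" and 1: "exec B c1 s u1 s1'" and 2: "exec B c2 s1' u2 s''"
    from Seq.IH(1)[OF 1] have "u1 = t1" "s1' = s1" by simp_all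
    with Seq.IH(2)[of u2 s''] 2 u show ?thesis by simp
  qed
next
  case (CondTrue p s c1 t s' c2)
  from CondTrue.prems show ?case
  proof (rule exec_CondE)
    fix u'
    assume u: "u = Suc (bcost p + u')" and 1: "exec B c1 s u' s''"
    from CondTrue.IH[OF 1] u show ?thesis by simp
  qed (use CondTrue.hyps in simp)
next
  case (CondFalse p s c2 t s' c1)
  from CondFalse.prems show ?case
  proof (rule exec_CondE)
    fix u'
    assume u: "u = Suc (bcost p + u')" and 1: "exec B c2 s u' s''"
    from CondFalse.IH[OF 1] u show ?thesis by simp
  qed (use CondFalse.hyps in simp)
next
  case (WhileFalse p s c)
  from WhileFalse.prems show ?case
    by (rule exec_WhileE) (use WhileFalse.hyps in simp_all)
next
  case (WhileTrue p s c t1 s1 t2 s2)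
  from WhileTrue.prems show ?case
  proof (rule exec_WhileE)
    fix u1 s1' u2
    assume u: "u = Suc (bcost p + u1 + u2)" and 1: "exec B c s u1 s1'"
      and 2: "exec B (While p c) s1' u2 s''"
    from WhileTrue.IH(1)[OF 1] have "u1 = t1" "s1' = s1" by simp_all
    with WhileTrue.IH(2)[of u2 s''] 2 u show ?thesis by simp
  qed (use WhileTrue.hyps in simp)
qed

text \<open>The input \<open>r\<close>, \<open>d\<close>, \<open>w\<close>: the letter \<open>x\<^sub>i\<close> (or its inverse) at position \<open>k\<close> of \<open>w\<close>, counted
  from 0, is given by \<open>gen[k] = i\<close> and \<open>sgn[k] = 1\<close> (or \<open>-1\<close>). All other memory contains 0.\<close>

definition input_store :: "nat \<Rightarrow> nat \<Rightarrow> word \<Rightarrow> store" where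
  "input_store r d w =
     \<lparr>vars = (\<lambda>_. 0)(''r'' := int r, ''d'' := int d, ''n'' := int (length w)),
      arrays = (\<lambda>_ _. 0)
        (''gen'' := (\<lambda>k. if 0 \<le> k \<and> k < int (length w) then int (fst (w ! nat k)) else 0),
         ''sgn'' := (\<lambda>k. if 0 \<le> k \<and> k < int (length w)
                         then (if snd (w ! nat k) then 1 else -1) else 0))\<rparr>"

end

theory Submission
  imports Defs "HOL-Algebra.Elementary_Groups"
begin

text \<open>
  Let \<open>H\<close> be normal in the free group \<open>F\<close>. A word lies in \<open>[H, H]\<close> iff the path that it labels in
  the Cayley graph of \<open>F/H\<close> traverses every edge as often forwards as backwards. The net number of
  traversals of an edge is additive on \<open>H\<close>, hence it vanishes on commutators. Conversely, a
  path with zero net traversals is closed, and a choice of coset representatives \<open>\<tau>\<close> turns its label,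
  up to conjugation, into a product of elements \<open>\<tau>(c) x \<tau>(c x)\<^sup>-\<^sup>1 \<in> H\<close> which cancel modulo \<open>[H, H]\<close>.

  Applied to \<open>H = F\<^sup>(\<^sup>m\<^sup>)\<close> and to subwords of \<open>w\<close>, this computes from the partition of the prefixes of \<open>w\<close>
  into cosets of \<open>F\<^sup>(\<^sup>m\<^sup>)\<close> the partition into cosets of the next derived subgroup: for every start \<open>a\<close>,
  the end \<open>b\<close> moves through \<open>w\<close> while net counts are kept for all edges. One level takes \<open>O(|w|\<^sup>3)\<close>
  steps.
\<close>

section \<open>Signed products and commutators\<close>

text \<open>Exponent sums: this is the image of the signed word in the free abelian group on its
  symbols.\<close>

definition flow :: "('e \<times> bool) list \<Rightarrow> 'e \<Rightarrow> int" where
  "flow xs e = (\<Sum>(e', s)\<leftarrow>xs. if e' = e then if s then 1 else -1 else 0)"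

lemma flow_Nil [simp]: "flow [] e = 0"
  by (simp add: flow_def)

lemma flow_Cons [simp]:
  "flow ((e', s) # xs) e = (if e' = e then if s then 1 else -1 else 0) + flow xs e"
  by (simp add: flow_def)

lemma flow_append [simp]: "flow (xs @ ys) e = flow xs e + flow ys e"
  by (simp add: flow_def)

lemma flow_pos: "flow xs e > 0 \<Longrightarrow> (e, True) \<in> set xs"
  by (induction xs) (auto split: if_splits)

lemma flow_neg: "flow xs e < 0 \<Longrightarrow> (e, False) \<in> set xs"
  by (induction xs) (auto split: if_splits)

definition signed_prod :: "('a, 'b) monoid_scheme \<Rightarrow> ('e \<Rightarrow> 'a) \<Rightarrow> ('e \<times> bool) list \<Rightarrow> 'a" where
  "signed_prod G f xs =
     foldr (\<lambda>(e, s) y. (if s then f e else inv\<^bsub>G\<^esub> (f e)) \<otimes>\<^bsub>G\<^esub> y) xs \<one>\<^bsub>G\<^esub>"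

lemma signed_prod_Nil [simp]: "signed_prod G f [] = \<one>\<^bsub>G\<^esub>"
  by (simp add: signed_prod_def)

lemma signed_prod_Cons [simp]:
  "signed_prod G f ((e, s) # xs) =
     (if s then f e else inv\<^bsub>G\<^esub> (f e)) \<otimes>\<^bsub>G\<^esub> signed_prod G f xs"
  by (simp add: signed_prod_def)

context group
begin

lemma signed_prod_in:
  assumes "subgroup H G" "\<And>e s. (e, s) \<in> set xs \<Longrightarrow> f e \<in> H"
  shows "signed_prod G f xs \<in> H"
  using assms(2)
proof (induction xs)
  case Nil
  then show ?case by (simp add: subgroup.one_closed[OF assms(1)])
next
  case (Cons x xs)
  obtain e s where x: "x = (e, s)" by (cases x)
  have "f e \<in> H" "signed_prod G f xs \<in> H"
    using Cons by (auto simp: x)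
  then show ?case
    by (simp add: x subgroup.m_closed[OF assms(1)] subgroup.m_inv_closed[OF assms(1)])
qed

lemma signed_prod_append:
  assumes "\<And>e s. (e, s) \<in> set (xs @ ys) \<Longrightarrow> f e \<in> carrier G"
  shows "signed_prod G f (xs @ ys) = signed_prod G f xs \<otimes> signed_prod G f ys"
  using assms
proof (induction xs)
  case Nil
  have "signed_prod G f ys \<in> carrier G"
    by (rule signed_prod_in[OF subgroup_self]) (use Nil in auto)
  then show ?case by simp
next
  case (Cons x xs)
  obtain e s where x: "x = (e, s)" by (cases x)
  have "signed_prod G f xs \<in> carrier G" "signed_prod G f ys \<in> carrier G"
    by (rule signed_prod_in[OF subgroup_self]; use Cons.prems in force)+
  moreover have "f e \<in> carrier G" using Cons.prems by (auto simp: x)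
  moreover have "signed_prod G f (xs @ ys) = signed_prod G f xs \<otimes> signed_prod G f ys"
    by (rule Cons.IH) (use Cons.prems in force)
  ultimately show ?case by (simp add: x m_assoc)
qed

lemma inv_mult_cancel: "x \<in> carrier G \<Longrightarrow> y \<in> carrier G \<Longrightarrow> inv x \<otimes> (x \<otimes> y) = y"
  by (simp add: m_assoc[symmetric])

lemma derived_commutator:
  assumes "h \<in> H" "k \<in> H"
  shows "h \<otimes> k \<otimes> inv h \<otimes> inv k \<in> derived G H"
  unfolding derived_def by (rule generate.incl) (use assms in blast)

text \<open>An element and a later inverse of it can be cancelled at the cost of a commutator.\<close>

lemma signed_prod_derived:
  assumes "subgroup H G" "\<And>e s. (e, s) \<in> set xs \<Longrightarrow> f e \<in> H" "\<And>e. flow xs e = 0"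
  shows "signed_prod G f xs \<in> derived G H"
  using assms(2,3)
proof (induction xs rule: length_induct)
  case (1 xs)
  interpret H: subgroup H G by fact
  interpret D: subgroup "derived G H" G
    by (rule derived_is_subgroup[OF H.subset])
  show ?case
  proof (cases xs)
    case Nil
    then show ?thesis by simp
  next
    case (Cons x us)
    obtain e s where x: "x = (e, s)" by (cases x)
    \<comment> \<open>The first entry contributes 1 or -1 to the flow of \<open>e\<close>, so the
      rest must contain \<open>e\<close> with the opposite sign.\<close>
    have "(e, \<not> s) \<in> set us"
      using "1.prems"(2)[of e] flow_pos[of us e] flow_neg[of us e] by (cases s) (auto simp: Cons x)
    then obtain ys zs where us: "us = ys @ (e, \<not> s) # zs"
      by (meson split_list)
    let ?P = "signed_prod G f"
    define a where "a = (if s then f e else inv (f e))"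
    have fe: "f e \<in> H" using "1.prems"(1) by (auto simp: Cons x)
    then have a: "a \<in> H" by (auto simp: a_def)
    have ys: "?P ys \<in> H" and zs: "?P zs \<in> H"
      by (rule signed_prod_in[OF assms(1)]; use "1.prems"(1) in \<open>force simp: Cons us\<close>)+
    have yz: "?P ys \<otimes> ?P zs = ?P (ys @ zs)"
      by (rule signed_prod_append[symmetric], rule H.mem_carrier)
        (use "1.prems"(1) in \<open>force simp: Cons us\<close>)
    have flow: "flow (ys @ zs) e' = 0" for e'
      using "1.prems"(2)[of e'] by (auto simp: Cons us x split: if_splits)
    have IH: "?P (ys @ zs) \<in> derived G H"
    proof (rule "1.IH"[rule_format])
      show "length (ys @ zs) < length xs" by (simp add: Cons us)
      show "f e' \<in> H" if "(e', s') \<in> set (ys @ zs)" for e' s'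
        using "1.prems"(1)[of e' s'] that by (auto simp: Cons us)
    qed (rule flow)
    have "?P us = ?P ys \<otimes> ?P ((e, \<not> s) # zs)"
      unfolding us
      by (rule signed_prod_append, rule H.mem_carrier)
        (use "1.prems"(1) in \<open>force simp: Cons us\<close>)
    also have "\<dots> = ?P ys \<otimes> (inv a \<otimes> ?P zs)"
      using fe by (simp add: a_def)
    finally have "?P xs = a \<otimes> (?P ys \<otimes> (inv a \<otimes> ?P zs))"
      by (simp add: Cons x a_def)
    \<comment> \<open>With \<open>y\<close> and \<open>z\<close> the products over \<open>ys\<close>
      and \<open>zs\<close>, this is the identity a y a^-1 z = [a, y] (y z), and the induction
      hypothesis applies to the shorter list \<open>ys @ zs\<close>.\<close>
    also have "\<dots> = (a \<otimes> ?P ys \<otimes> inv a \<otimes> inv (?P ys)) \<otimes> (?P ys \<otimes> ?P zs)"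
      using a ys zs by (simp add: m_assoc inv_mult_cancel)
    also have "\<dots> \<in> derived G H"
      unfolding yz by (rule D.m_closed[OF derived_commutator[OF a ys] IH])
    finally show ?thesis .
  qed
qed

end

section \<open>Paths in Cayley graphs of quotients of the free group\<close>

text \<open>The edge \<open>(c, i)\<close> leads from the coset \<open>c\<close> to \<open>c x\<^sub>i\<close>; an inverse letter traverses the edge that
  starts in the coset reached.\<close>

fun trail :: "nat \<Rightarrow> word set \<Rightarrow> word \<Rightarrow> word \<Rightarrow> ((word set \<times> nat) \<times> bool) list" where
  "trail r H g [] = []"
| "trail r H g (x # v) =
     ((H #>\<^bsub>free_group r\<^esub> (if snd x then g else reduce (g @ [x])), fst x), snd x)
       # trail r H (reduce (g @ [x])) v"

lemma carrier_free_group: "carrier (free_group r) = {w \<in> words r. reduced w}"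
  and mult_free_group: "u \<otimes>\<^bsub>free_group r\<^esub> v = reduce (u @ v)"
  and one_free_group: "\<one>\<^bsub>free_group r\<^esub> = []"
  by (simp_all add: free_group_def)

lemma reduce_in_carrier: "v \<in> words r \<Longrightarrow> reduce v \<in> carrier (free_group r)"
  by (simp add: carrier_free_group words_reduce reduced_reduce)

lemma words_Cons: "x # v \<in> words r \<longleftrightarrow> [x] \<in> words r \<and> v \<in> words r"
  by (auto simp: words_def)

lemma letter_in_carrier: "[x] \<in> words r \<Longrightarrow> [x] \<in> carrier (free_group r)"
  by (simp add: carrier_free_group reduced_def)

lemma inv_letter_in_words: "[x] \<in> words r \<Longrightarrow> [inv_letter x] \<in> words r"
  by (simp add: words_def inv_letter_def)

lemma inv_letter_free_group:
  assumes "[x] \<in> words r"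
  shows "inv\<^bsub>free_group r\<^esub> [x] = [inv_letter x]"
proof -
  interpret group "free_group r" by (rule group_free_group)
  show ?thesis
    by (rule inv_equality)
      (use assms in \<open>simp_all add: letter_in_carrier inv_letter_in_words mult_free_group
          one_free_group reduce_def\<close>)
qed

lemma reduce_hom:
  "reduce (u @ v) = reduce u \<otimes>\<^bsub>free_group r\<^esub> reduce v"
  by (simp add: mult_free_group reduce_append_reduce)

locale normal_free_group = normal H "free_group r" for r H
begin

abbreviation "F \<equiv> free_group r"

lemma reduce_snoc_carrier:
  "g \<in> carrier F \<Longrightarrow> [x] \<in> words r \<Longrightarrow> reduce (g @ [x]) \<in> carrier F"
  by (rule reduce_in_carrier) (simp add: carrier_free_group words_append)

lemma coset_snoc:
  assumes "g \<in> carrier F" "[x] \<in> words r"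
  shows "H #>\<^bsub>F\<^esub> reduce (g @ [x]) = (H #>\<^bsub>F\<^esub> g) #>\<^bsub>F\<^esub> [x]"
  using coset_mult_assoc[OF subset assms(1) letter_in_carrier[OF assms(2)]]
  by (simp add: mult_free_group)

lemma trail_append:
  "trail r H g (u @ v) = trail r H g u @ trail r H (reduce (g @ u)) v"
  if "reduced g"
  using that
proof (induction u arbitrary: g)
  case Nil
  then show ?case by (simp add: reduce_reduced)
next
  case (Cons x u)
  then show ?case
    by (simp add: reduced_reduce reduce_append_reduce)
qed

text \<open>Edges record cosets only, and right multiplication by a letter is well defined on right
  cosets.\<close>

lemma trail_cong_coset:
  assumes "g \<in> carrier F" "h \<in> carrier F" "v \<in> words r" "H #>\<^bsub>F\<^esub> g = H #>\<^bsub>F\<^esub> h"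
  shows "trail r H g v = trail r H h v"
  using assms
proof (induction v arbitrary: g h)
  case (Cons x v)
  have x: "[x] \<in> words r" "v \<in> words r"
    using Cons.prems(3) by (simp_all add: words_Cons[of x v])
  have eq: "H #>\<^bsub>F\<^esub> reduce (g @ [x]) = H #>\<^bsub>F\<^esub> reduce (h @ [x])"
    using Cons.prems x by (simp add: coset_snoc)
  with Cons x show ?case by (auto simp: reduce_snoc_carrier)
qed simp

section \<open>Net flow as a homomorphism on \<open>H\<close>\<close>

lemma reduce_cancel:
  assumes "g \<in> carrier F"
  shows "reduce (reduce (g @ [x]) @ [inv_letter x]) = g"
proof -
  have "reduce (g @ [x, inv_letter x]) = reduce (g @ reduce [x, inv_letter x])"
    by (rule reduce_append_reduce(2)[symmetric])
  also have "\<dots> = g" using assms by (simp add: carrier_free_group reduce_reduced reduce_def[of "[_,_]"])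
  finally show ?thesis by (simp add: reduce_append_reduce)
qed

text \<open>A letter followed by its inverse crosses the same edge once in each direction, so a
  cancellation removes two opposite contributions.\<close>

lemma flow_trail_red_Cons:
  assumes "g \<in> carrier F"
  shows "flow (trail r H g (red_Cons x v)) e = flow (trail r H g (x # v)) e"
proof (cases v)
  case (Cons y ys)
  show ?thesis
  proof (cases "y = inv_letter x")
    case True
    then show ?thesis
      using reduce_cancel[OF assms, of x] by (simp add: Cons) (simp add: inv_letter_def)
  qed (simp add: Cons)
qed simp

lemma flow_trail_reduce:
  assumes "g \<in> carrier F" "v \<in> words r"
  shows "flow (trail r H g (reduce v)) e = flow (trail r H g v) e"
  using assms
proof (induction v arbitrary: g)
  case (Cons x v)
  have x: "[x] \<in> words r" "v \<in> words r"
    using Cons.prems(2) by (simp_all add: words_Cons[of x v])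
  have "flow (trail r H g (reduce (x # v))) e = flow (trail r H g (x # reduce v)) e"
    using flow_trail_red_Cons[OF Cons.prems(1)] by (simp add: reduce_def)
  then show ?case
    using Cons.IH[OF reduce_snoc_carrier[OF Cons.prems(1) x(1)] x(2)] by simp
qed (simp add: reduce_def)

lemma flow_trail_mult:
  assumes "g \<in> carrier F" "u \<in> carrier F" "v \<in> carrier F"
  shows "flow (trail r H g (u \<otimes>\<^bsub>F\<^esub> v)) e
    = flow (trail r H g u) e + flow (trail r H (g \<otimes>\<^bsub>F\<^esub> u) v) e"
proof -
  have "flow (trail r H g (reduce (u @ v))) e = flow (trail r H g (u @ v)) e"
    by (rule flow_trail_reduce) (use assms in \<open>auto simp: carrier_free_group words_append\<close>)
  then show ?thesis
    using assms(1) by (simp add: mult_free_group trail_append carrier_free_group)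
qed

text \<open>By normality \<open>H g\<close> is also the left coset \<open>g H\<close>, and
  \<open>g u\<close> lies in \<open>g H\<close> exactly when \<open>u\<close> is in
  \<open>H\<close>.\<close>

lemma coset_mult_eq_iff:
  assumes "g \<in> carrier F" "u \<in> carrier F"
  shows "H #>\<^bsub>F\<^esub> g = H #>\<^bsub>F\<^esub> (g \<otimes>\<^bsub>F\<^esub> u) \<longleftrightarrow> u \<in> H"
proof -
  have gu: "g \<otimes>\<^bsub>F\<^esub> u \<in> carrier F" using assms by simp
  have "H #>\<^bsub>F\<^esub> g = H #>\<^bsub>F\<^esub> (g \<otimes>\<^bsub>F\<^esub> u) \<longleftrightarrow> g \<otimes>\<^bsub>F\<^esub> u \<in> H #>\<^bsub>F\<^esub> g"
    using repr_independence[OF _ assms(1) is_subgroup] rcos_self[OF gu is_subgroup] by auto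
  also have "\<dots> \<longleftrightarrow> g \<otimes>\<^bsub>F\<^esub> u \<in> g <#\<^bsub>F\<^esub> H"
    using coset_eq assms(1) by simp
  also have "\<dots> \<longleftrightarrow> u \<in> H"
    using assms by (auto simp: l_coset_def)
  finally show ?thesis .
qed

lemma coset_mult_in:
  assumes "g \<in> carrier F" "u \<in> H"
  shows "H #>\<^bsub>F\<^esub> (g \<otimes>\<^bsub>F\<^esub> u) = H #>\<^bsub>F\<^esub> g"
  using coset_mult_eq_iff[of g u] assms mem_carrier by simp

text \<open>The path of \<open>u\<close> returns to the coset of \<open>g\<close>, so the path of
  \<open>v\<close> starts where that of \<open>u\<close> did. For fixed \<open>g\<close> and
  \<open>e\<close> the flow is thus a homomorphism from \<open>H\<close> to the integers.\<close>

lemma flow_trail_mult_in: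
  assumes "g \<in> carrier F" "u \<in> H" "v \<in> H"
  shows "flow (trail r H g (u \<otimes>\<^bsub>F\<^esub> v)) e = flow (trail r H g u) e + flow (trail r H g v) e"
proof -
  have "trail r H (g \<otimes>\<^bsub>F\<^esub> u) v = trail r H g v"
    by (rule trail_cong_coset[OF _ _ _ coset_mult_in])
      (use assms carrier_free_group[of r] in \<open>auto dest: mem_carrier\<close>)
  then show ?thesis using flow_trail_mult assms by simp
qed

lemma flow_trail_inv:
  assumes "g \<in> carrier F" "u \<in> H"
  shows "flow (trail r H g (inv\<^bsub>F\<^esub> u)) e = - flow (trail r H g u) e"
proof -
  have "flow (trail r H g (u \<otimes>\<^bsub>F\<^esub> inv\<^bsub>F\<^esub> u)) e
      = flow (trail r H g u) e + flow (trail r H g (inv\<^bsub>F\<^esub> u)) e"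
    by (rule flow_trail_mult_in) (use assms in auto)
  then show ?thesis using assms by (simp add: one_free_group)
qed

lemma flow_trail_derived:
  assumes "g \<in> carrier F" "u \<in> derived F H"
  shows "flow (trail r H g u) e = 0"
proof -
  \<comment> \<open>Membership in \<open>H\<close> is carried through the induction because
    additivity of the flow holds for factors in \<open>H\<close>.\<close>
  have "u \<in> H \<and> flow (trail r H g u) e = 0"
    using assms(2) unfolding derived_def
  proof (induction rule: generate.induct)
    case one
    then show ?case using subgroup.one_closed[OF is_subgroup] by (simp add: one_free_group)
  next
    case (incl h)
    then show ?case using assms(1) by (auto simp: flow_trail_mult_in flow_trail_inv)
  next
    case (inv h)
    then show ?case using assms(1) by (auto simp: flow_trail_mult_in flow_trail_inv)
  next
    case (eng h1 h2)
    then show ?case using assms(1) by (simp add: flow_trail_mult_in)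
  qed
  then show ?thesis ..
qed

section \<open>Telescoping along a path and the criterion for \<open>[H, H]\<close>\<close>

text \<open>The product telescopes: the inverse of \<open>\<tau>\<close> at the end of each edge
  cancels against \<open>\<tau>\<close> at the start of the next. The target group \<open>K\<close>
  is kept general for two uses: the integers with trivial \<open>\<rho>\<close> detect whether a
  path is closed, and the free group itself recovers the label.\<close>

lemma signed_prod_trail:
  fixes K (structure)
  assumes "group K" "\<rho> \<in> hom F K" "\<And>c. \<tau> c \<in> carrier K"
    and "g \<in> carrier F" "v \<in> words r"
  defines "f \<equiv> \<lambda>(c, i). \<tau> c \<otimes> \<rho> [(i, True)] \<otimes> inv (\<tau> (c #>\<^bsub>F\<^esub> [(i, True)]))"
  shows "signed_prod K f (trail r H g v)
    = \<tau> (H #>\<^bsub>F\<^esub> g) \<otimes> \<rho> (reduce v) \<otimes> inv (\<tau> (H #>\<^bsub>F\<^esub> reduce (g @ v)))"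
  using assms(4,5)
proof (induction v arbitrary: g)
  interpret K: group K by fact
  interpret \<rho>: group_hom F K \<rho>
    using assms(2) by unfold_locales
  case Nil
  then show ?case
    using assms(3) \<rho>.hom_one by (simp add: reduce_def[of "[]"] reduce_reduced carrier_free_group one_free_group)
next
  interpret K: group K by fact
  interpret \<rho>: group_hom F K \<rho>
    using assms(2) by unfold_locales
  case (Cons x v)
  have x: "[x] \<in> words r" "v \<in> words r"
    using Cons.prems(2) by (simp_all add: words_Cons[of x v])
  obtain i s where xi: "x = (i, s)" by (cases x)
  let ?g = "reduce (g @ [x])"
  let ?a = "\<tau> (H #>\<^bsub>F\<^esub> g)" and ?b = "\<tau> (H #>\<^bsub>F\<^esub> ?g)"
  have g: "?g \<in> carrier F" by (rule reduce_snoc_carrier[OF Cons.prems(1) x(1)])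
  have rx: "\<rho> [x] \<in> carrier K" by (rule \<rho>.hom_closed[OF letter_in_carrier[OF x(1)]])
  have rv: "\<rho> (reduce v) \<in> carrier K" by (rule \<rho>.hom_closed[OF reduce_in_carrier[OF x(2)]])
  have step: "signed_prod K f (trail r H g (x # v)) =
     (?a \<otimes> \<rho> [x] \<otimes> inv ?b) \<otimes> signed_prod K f (trail r H ?g v)"
  proof (cases s)
    case True
    then show ?thesis
      using coset_snoc[OF Cons.prems(1) x(1)] by (simp add: xi f_def)
  next
    case False
    \<comment> \<open>An inverse letter crosses its edge from target to source, so inverting the
      value of \<open>f\<close> at this edge gives the same shape of factor as for a positive
      letter.\<close>
    let ?y = "[(i, True)]"
    have y: "?y \<in> words r" "?y = [inv_letter x]"
      using inv_letter_in_words[OF x(1)] by (simp_all add: xi inv_letter_def False)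
    have ry: "\<rho> ?y = inv (\<rho> [x])"
      using \<rho>.hom_inv[OF letter_in_carrier[OF x(1)]] inv_letter_free_group[OF x(1)] y by simp
    have "H #>\<^bsub>F\<^esub> ?g #>\<^bsub>F\<^esub> ?y = H #>\<^bsub>F\<^esub> g"
      using coset_snoc[OF g y(1)] reduce_cancel[OF Cons.prems(1), of x] y(2) by simp
    then have "f (H #>\<^bsub>F\<^esub> ?g, i) = ?b \<otimes> inv (\<rho> [x]) \<otimes> inv ?a"
      by (simp add: f_def ry)
    then have "inv (f (H #>\<^bsub>F\<^esub> ?g, i)) = ?a \<otimes> \<rho> [x] \<otimes> inv ?b"
      using rx assms(3) by (simp add: K.inv_mult_group K.m_assoc)
    then show ?thesis using False by (simp add: xi)
  qed
  have r: "\<rho> (reduce (x # v)) = \<rho> [x] \<otimes> \<rho> (reduce v)"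
    using reduce_hom[of "[x]" v r] \<rho>.hom_mult[OF letter_in_carrier[OF x(1)] reduce_in_carrier[OF x(2)]]
    by (simp add: reduce_reduced reduced_def)
  have gv: "reduce (?g @ v) = reduce (g @ x # v)"
    by (simp add: reduce_append_reduce)
  show ?case
    unfolding step Cons.IH[OF g x(2)] r gv
    using rx rv assms(3) by (simp add: K.m_assoc K.inv_mult_cancel)
qed

text \<open>The starting vertex \<open>g\<close> is arbitrary, so that the criterion can be applied
  to a subword of \<open>w\<close> that starts at the vertex of the preceding prefix.\<close>

theorem in_derived_iff_flow:
  assumes g: "g \<in> carrier F" and v: "v \<in> words r"
  shows "reduce v \<in> derived F H \<longleftrightarrow> (\<forall>e. flow (trail r H g v) e = 0)"
proof
  assume "reduce v \<in> derived F H"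
  then show "\<forall>e. flow (trail r H g v) e = 0"
    using flow_trail_derived[OF g] flow_trail_reduce[OF g v] by simp
next
  assume flow: "\<forall>e. flow (trail r H g v) e = 0"
  let ?c = "\<lambda>h. H #>\<^bsub>F\<^esub> h"
  have gv: "reduce (g @ v) \<in> carrier F"
    by (rule reduce_in_carrier) (use g v in \<open>simp add: carrier_free_group words_append\<close>)
  have closed: "?c (reduce (g @ v)) = ?c g"
  proof (rule ccontr)
    assume ne: "?c (reduce (g @ v)) \<noteq> ?c g"
    \<comment> \<open>The indicator of the starting coset serves as a potential. Zero flow forces
      its total change along the path to be 0, whereas a path that ends elsewhere would give
      1.\<close>
    define \<tau> where "\<tau> c = (if c = ?c g then 1 else 0 :: int)" for c
    interpret Z: comm_group integer_group
      by (rule abelian_integer_group)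
    have "signed_prod integer_group (\<lambda>(c, i). \<tau> c \<otimes>\<^bsub>integer_group\<^esub> 0 \<otimes>\<^bsub>integer_group\<^esub>
        inv\<^bsub>integer_group\<^esub> \<tau> (c #>\<^bsub>F\<^esub> [(i, True)])) (trail r H g v) \<in> derived integer_group UNIV"
      by (rule Z.signed_prod_derived) (use flow Z.subgroup_self in auto)
    moreover have "derived integer_group UNIV = {0}"
      using Z.derived_eq_singleton[of UNIV] by simp
    moreover note signed_prod_trail[OF group_integer_group _ _ g v, of "\<lambda>_. 0" \<tau>]
    ultimately have "1 \<otimes>\<^bsub>integer_group\<^esub> inv\<^bsub>integer_group\<^esub> 0 = (0 :: int)"
      using ne by (simp add: hom_def \<tau>_def)
    then show False by simp
  qed
  \<comment> \<open>A transversal of the cosets; the default outside them makes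
    \<open>\<tau>\<close> carrier-valued everywhere, as \<open>signed_prod_trail\<close>
    demands.\<close>
  define \<tau> where "\<tau> c = (if c \<in> rcosets\<^bsub>F\<^esub> H then SOME h. h \<in> c else \<one>\<^bsub>F\<^esub>)" for c
  have \<tau>: "\<tau> (?c h) \<in> carrier F \<and> ?c (\<tau> (?c h)) = ?c h" if "h \<in> carrier F" for h
  proof -
    have "?c h \<in> rcosets\<^bsub>F\<^esub> H" using that by (auto simp: RCOSETS_def)
    then have in_coset: "\<tau> (?c h) \<in> ?c h"
      using someI[of "\<lambda>h'. h' \<in> ?c h", OF rcos_self[OF that is_subgroup]] by (simp add: \<tau>_def)
    then show ?thesis
      using repr_independence[OF in_coset that is_subgroup] elemrcos_carrier[OF is_group that in_coset]
      by simp
  qed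
  have \<tau>_carrier: "\<tau> c \<in> carrier F" for c
  proof (cases "c \<in> rcosets\<^bsub>F\<^esub> H")
    case True
    then obtain h where "h \<in> carrier F" "c = ?c h" by (auto simp: RCOSETS_def)
    then show ?thesis using \<tau> by simp
  qed (simp add: \<tau>_def)
  let ?f = "\<lambda>(c, i). \<tau> c \<otimes>\<^bsub>F\<^esub> [(i, True)] \<otimes>\<^bsub>F\<^esub> inv\<^bsub>F\<^esub> \<tau> (c #>\<^bsub>F\<^esub> [(i, True)])"
  \<comment> \<open>Every edge met starts in a genuine coset and carries a generator of rank at most
    \<open>r\<close>. There \<open>\<tau>(c) x\<close> and \<open>\<tau>(c x)\<close> represent the
    same coset, so their quotient lies in \<open>H\<close>.\<close>
  have fN: "?f e \<in> H" if "(e, s) \<in> set (trail r H g v)" for e s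
  proof -
    have "\<exists>h i. h \<in> carrier F \<and> [(i, True)] \<in> words r \<and> e = (?c h, i)"
      using that g v
    proof (induction v arbitrary: g)
      case (Cons x v)
      have x: "[x] \<in> words r" "v \<in> words r"
        using Cons.prems(3) by (simp_all add: words_Cons[of x v])
      have g': "reduce (g @ [x]) \<in> carrier F"
        by (rule reduce_snoc_carrier[OF Cons.prems(2) x(1)])
      have y: "[(fst x, True)] \<in> words r" using x by (simp add: words_def)
      consider "e = (?c g, fst x)" | "e = (?c (reduce (g @ [x])), fst x)"
        | "(e, s) \<in> set (trail r H (reduce (g @ [x])) v)"
        using Cons.prems(1) by (auto split: if_splits)
      then show ?case
      proof cases
        case 1
        with Cons.prems(2) y show ?thesis by blast
      next
        case 2
        with g' y show ?thesis by blast
      next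
        case 3
        from Cons.IH[OF 3 g' x(2)] show ?thesis .
      qed
    qed simp
    then obtain h i where h: "h \<in> carrier F" and i: "[(i, True)] \<in> words r" and e: "e = (?c h, i)"
      by blast
    let ?y = "[(i, True)]"
    have y: "?y \<in> carrier F" by (rule letter_in_carrier[OF i])
    have hy: "h \<otimes>\<^bsub>F\<^esub> ?y \<in> carrier F" using h y by simp
    have "?c h #>\<^bsub>F\<^esub> ?y = ?c (h \<otimes>\<^bsub>F\<^esub> ?y)"
      by (rule coset_mult_assoc[OF subset h y])
    moreover have "?c (\<tau> (?c h) \<otimes>\<^bsub>F\<^esub> ?y) = ?c h #>\<^bsub>F\<^esub> ?y"
      using coset_mult_assoc[OF subset _ y, of "\<tau> (?c h)"] \<tau>[OF h] by simp
    ultimately have "?c (\<tau> (?c h) \<otimes>\<^bsub>F\<^esub> ?y) = ?c (\<tau> (?c h #>\<^bsub>F\<^esub> ?y))"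
      using \<tau>[OF hy] by simp
    then have "\<tau> (?c h) \<otimes>\<^bsub>F\<^esub> ?y \<in> ?c (\<tau> (?c h #>\<^bsub>F\<^esub> ?y))"
      using rcos_self[OF _ is_subgroup, of "\<tau> (?c h) \<otimes>\<^bsub>F\<^esub> ?y"] \<tau>_carrier y by simp
    then show ?thesis
      unfolding e using rcos_module_imp[OF is_group \<tau>_carrier] by simp
  qed
  interpret D: normal "derived F H" F
    by (rule derived_is_normal[OF normal_axioms])
  let ?t = "\<tau> (?c g)"
  have "signed_prod F ?f (trail r H g v) \<in> derived F H"
    by (rule signed_prod_derived[OF is_subgroup]) (use fN flow in auto)
  \<comment> \<open>Since the path is closed, both ends have the same representative and the
    telescoped product is a conjugate of the label.\<close>
  also have "signed_prod F ?f (trail r H g v) = ?t \<otimes>\<^bsub>F\<^esub> reduce v \<otimes>\<^bsub>F\<^esub> inv\<^bsub>F\<^esub> ?t"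
    using signed_prod_trail[OF is_group _ \<tau>_carrier g v, of "\<lambda>x. x"] by (simp add: closed hom_def)
  \<comment> \<open>Conjugating back stays inside \<open>derived F H\<close>, which is normal
    because \<open>H\<close> is.\<close>
  finally have "inv\<^bsub>F\<^esub> ?t \<otimes>\<^bsub>F\<^esub> (?t \<otimes>\<^bsub>F\<^esub> reduce v \<otimes>\<^bsub>F\<^esub> inv\<^bsub>F\<^esub> ?t) \<otimes>\<^bsub>F\<^esub> ?t \<in> derived F H"
    by (rule D.inv_op_closed1[OF \<tau>_carrier])
  then show "reduce v \<in> derived F H"
    using \<tau>_carrier reduce_in_carrier[OF v] by (simp add: m_assoc inv_mult_cancel)
qed

section \<open>Subwords of the input word\<close>

definition vertex :: "word \<Rightarrow> nat \<Rightarrow> word set" where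
  "vertex w k = H #>\<^bsub>F\<^esub> reduce (take k w)"

definition edge :: "word \<Rightarrow> nat \<Rightarrow> word set \<times> nat" where
  "edge w k = (vertex w (if snd (w ! k) then k else Suc k), fst (w ! k))"

lemma reduce_take_append:
  assumes "a \<le> b"
  shows "reduce (reduce (take a w) @ drop a (take b w)) = reduce (take b w)"
proof -
  have "take a w @ drop a (take b w) = take b w"
    using append_take_drop_id[of a "take b w"] assms by (simp add: min_absorb1)
  then show ?thesis by (simp add: reduce_append_reduce)
qed

lemma flow_subword:
  assumes "a \<le> b" "b \<le> length w"
  shows "flow (trail r H (reduce (take a w)) (drop a (take b w))) e
    = (\<Sum>k\<in>{a..<b}. if edge w k = e then if snd (w ! k) then 1 else -1 else 0)"
  using assms
proof (induction b rule: dec_induct)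
  case (step b)
  have "drop a (take (Suc b) w) = drop a (take b w) @ [w ! b]"
    using step by (simp add: take_Suc_conv_app_nth)
  moreover have "reduce (reduce (take b w) @ [w ! b]) = reduce (take (Suc b) w)"
    using step.prems by (simp add: reduce_append_reduce take_Suc_conv_app_nth)
  ultimately show ?case
    using step by (simp add: trail_append reduced_reduce reduce_take_append edge_def vertex_def)
qed simp

text \<open>An edge that the subword never crosses has net count 0, so it suffices to test the edges
  at the positions of \<open>w\<close>: infinitely many conditions become \<open>length w\<close>
  many.\<close>

lemma subword_in_derived_iff:
  assumes "w \<in> words r" "a \<le> b" "b \<le> length w"
  shows "reduce (drop a (take b w)) \<in> derived F H \<longleftrightarrow>
    (\<forall>j<length w. (\<Sum>k\<in>{a..<b}. if edge w k = edge w j then if snd (w ! k) then 1 else -1 else 0)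
      = (0 :: int))"
    (is "_ \<longleftrightarrow> (\<forall>j<length w. ?net (edge w j) = 0)")
proof -
  have sub: "take a w \<in> words r" "drop a (take b w) \<in> words r"
    using assms(1) by (auto simp: words_def dest: in_set_takeD in_set_dropD)
  have "reduce (drop a (take b w)) \<in> derived F H \<longleftrightarrow> (\<forall>e. ?net e = 0)"
    using in_derived_iff_flow[OF reduce_in_carrier[OF sub(1)] sub(2)] flow_subword[OF assms(2,3)]
    by simp
  also have "\<dots> \<longleftrightarrow> (\<forall>j<length w. ?net (edge w j) = 0)"
  proof (intro iffI allI)
    fix e assume net: "\<forall>j<length w. ?net (edge w j) = 0"
    show "?net e = 0"
    proof (cases "\<exists>j\<in>{a..<b}. edge w j = e")
      case True
      then show ?thesis using net assms(3) by force
    next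
      case False
      then show ?thesis by (intro sum.neutral) auto
    qed
  qed blast
  finally show ?thesis .
qed

end

section \<open>The derived series and the recursion between its levels\<close>

lemma derived_term_Suc: "derived_term r (Suc m) = derived (free_group r) (derived_term r m)"
  by (simp add: derived_term_def)

lemma derived_term_normal: "normal_free_group r (derived_term r m)"
proof -
  interpret group "free_group r" by (rule group_free_group)
  have "derived_term r m \<lhd> free_group r"
  proof (induction m)
    case 0
    then show ?case using normal_self by (simp add: derived_term_def)
  next
    case (Suc m)
    then show ?case by (simp add: derived_term_Suc derived_is_normal)
  qed
  then show ?thesis by (simp add: normal_free_group_def)
qed

text \<open>Two prefixes are in the same coset iff the subword between them lies in the derived
  term. The right-hand side uses cosets of level \<open>m\<close> only through equality, so a
  program may replace them by numerical identifiers.\<close>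

lemma derived_term_coset_Suc_iff:
  fixes r m w
  defines "cls \<equiv> \<lambda>m k. derived_term r m #>\<^bsub>free_group r\<^esub> reduce (take k w)"
  assumes "w \<in> words r" "a \<le> b" "b \<le> length w"
  shows "cls (Suc m) a = cls (Suc m) b \<longleftrightarrow>
    (\<forall>j<length w. (\<Sum>k\<in>{a..<b}. if fst (w ! k) = fst (w ! j) \<and>
        cls m (if snd (w ! k) then k else Suc k) = cls m (if snd (w ! j) then j else Suc j)
      then if snd (w ! k) then 1 else -1 else 0) = (0 :: int))"
proof -
  interpret H: normal_free_group r "derived_term r m" by (rule derived_term_normal)
  interpret D: normal_free_group r "derived_term r (Suc m)" by (rule derived_term_normal)
  have sub: "take a w \<in> words r" "drop a (take b w) \<in> words r"
    using assms(2) by (auto simp: words_def dest: in_set_takeD in_set_dropD)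
  have "cls (Suc m) a = cls (Suc m) b \<longleftrightarrow> reduce (drop a (take b w)) \<in> derived_term r (Suc m)"
    using D.coset_mult_eq_iff[OF reduce_in_carrier[OF sub(1)] reduce_in_carrier[OF sub(2)]]
      D.reduce_take_append[OF assms(3)]
    by (simp add: cls_def mult_free_group reduce_append_reduce)
  then show ?thesis
    using H.subword_in_derived_iff[OF assms(2-4)]
    by (simp add: derived_term_Suc H.edge_def H.vertex_def cls_def conj_commute)
qed

text \<open>The identity of the quotient is the subgroup itself, which is the coset of the empty
  prefix. The word problem becomes a comparison of the first and the last position.\<close>

lemma word_class_eq_one_iff:
  "word_class r d w = \<one>\<^bsub>free_solvable_group r d\<^esub> \<longleftrightarrow>
    derived_term r d #>\<^bsub>free_group r\<^esub> reduce (take 0 w)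
      = derived_term r d #>\<^bsub>free_group r\<^esub> reduce (take (length w) w)"
proof -
  interpret normal_free_group r "derived_term r d" by (rule derived_term_normal)
  have "derived_term r d #>\<^bsub>F\<^esub> [] = derived_term r d"
    using coset_mult_one[OF subset] by (simp add: one_free_group)
  then show ?thesis
    by (auto simp: word_class_def free_solvable_group_def FactGroup_def reduce_def[of "[]"])
qed

section \<open>Total correctness with running times\<close>

text \<open>For loop-free programs only: \<open>While\<close> gets the junk values \<open>False\<close> and \<open>0\<close>.\<close>

fun wp :: "int \<Rightarrow> com \<Rightarrow> (store \<Rightarrow> bool) \<Rightarrow> store \<Rightarrow> bool" where
  "wp B Skip Q s \<longleftrightarrow> Q s"
| "wp B (Assign x a) Q s \<longleftrightarrow> asafe B a s \<and> Q (s\<lparr>vars := (vars s)(x := aval a s)\<rparr>)"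
| "wp B (Update A a b) Q s \<longleftrightarrow> asafe B a s \<and> 0 \<le> aval a s \<and> asafe B b s \<and>
     Q (s\<lparr>arrays := (arrays s)(A := (arrays s A)(aval a s := aval b s))\<rparr>)"
| "wp B (Seq c1 c2) Q s \<longleftrightarrow> wp B c1 (wp B c2 Q) s"
| "wp B (Cond p c1 c2) Q s \<longleftrightarrow>
     bsafe B p s \<and> (bval p s \<longrightarrow> wp B c1 Q s) \<and> (\<not> bval p s \<longrightarrow> wp B c2 Q s)"
| "wp B (While p c) Q s \<longleftrightarrow> False"

fun ccost :: "com \<Rightarrow> nat" where
  "ccost Skip = 1"
| "ccost (Assign x a) = acost a + 1"
| "ccost (Update A a b) = acost a + acost b + 1"
| "ccost (Seq c1 c2) = ccost c1 + ccost c2"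
| "ccost (Cond p c1 c2) = bcost p + 1 + max (ccost c1) (ccost c2)"
| "ccost (While p c) = 0"

text \<open>The time \<open>t\<close> is an upper bound, so branches of different cost share one
  specification.\<close>

definition runs :: "int \<Rightarrow> com \<Rightarrow> store \<Rightarrow> nat \<Rightarrow> (store \<Rightarrow> bool) \<Rightarrow> bool" where
  "runs B c s t Q \<longleftrightarrow> (\<exists>t' s'. exec B c s t' s' \<and> t' \<le> t \<and> Q s')"

lemma runs_weaken:
  "runs B c s t Q \<Longrightarrow> t \<le> t' \<Longrightarrow> (\<And>s. Q s \<Longrightarrow> Q' s) \<Longrightarrow> runs B c s t' Q'"
  unfolding runs_def by (meson order_trans)

lemma runs_Seq:
  assumes "runs B c1 s t1 R" "\<And>s'. R s' \<Longrightarrow> runs B c2 s' t2 Q" "t1 + t2 \<le> t"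
  shows "runs B (Seq c1 c2) s t Q"
proof -
  obtain u1 s1 where 1: "exec B c1 s u1 s1" "u1 \<le> t1" "R s1"
    using assms(1) by (auto simp: runs_def)
  obtain u2 s2 where 2: "exec B c2 s1 u2 s2" "u2 \<le> t2" "Q s2"
    using assms(2)[OF 1(3)] by (auto simp: runs_def)
  have "u1 + u2 \<le> t" using 1(2) 2(2) assms(3) by simp
  with exec.Seq[OF 1(1) 2(1)] 2(3) show ?thesis unfolding runs_def by blast
qed

lemma wp_runs: "wp B c Q s \<Longrightarrow> runs B c s (ccost c) Q"
proof (induction c arbitrary: Q s)
  case Skip
  then show ?case unfolding runs_def using exec.Skip by fastforce
next
  case (Assign x a)
  then show ?case unfolding runs_def using exec.Assign[of B a s x] by auto
next
  case (Update A a b)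
  then show ?case unfolding runs_def using exec.Update[of B a s b A] by auto
next
  case (Seq c1 c2)
  have "runs B c1 s (ccost c1) (wp B c2 Q)" using Seq by simp
  then show ?case by (rule runs_Seq[OF _ Seq.IH(2)]) simp_all
next
  case (Cond p c1 c2)
  show ?case
  proof (cases "bval p s")
    case True
    with Cond have "runs B c1 s (ccost c1) Q" by simp
    then obtain t s' where "exec B c1 s t s'" "t \<le> ccost c1" "Q s'"
      by (auto simp: runs_def)
    moreover from this True Cond.prems have "exec B (Cond p c1 c2) s (bcost p + 1 + t) s'"
      by (intro exec.CondTrue) simp_all
    ultimately show ?thesis unfolding runs_def by (intro exI conjI) auto
  next
    case False
    with Cond have "runs B c2 s (ccost c2) Q" by simp
    then obtain t s' where "exec B c2 s t s'" "t \<le> ccost c2" "Q s'"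
      by (auto simp: runs_def)
    moreover from this False Cond.prems have "exec B (Cond p c1 c2) s (bcost p + 1 + t) s'"
      by (intro exec.CondFalse) simp_all
    ultimately show ?thesis unfolding runs_def by (intro exI conjI) auto
  qed
qed simp

lemma wp_mono: "wp B c Q s \<Longrightarrow> (\<And>s. Q s \<Longrightarrow> Q' s) \<Longrightarrow> wp B c Q' s"
proof (induction c arbitrary: Q Q' s)
  case (Seq c1 c2)
  then show ?case by (metis wp.simps(4))
qed auto

lemma runs_wp: "wp B c Q s \<Longrightarrow> ccost c \<le> t \<Longrightarrow> runs B c s t Q"
  by (rule runs_weaken[OF wp_runs])

text \<open>The invariant is indexed by a counter that serves as the variant: each round advances it
  by one and the loop stops exactly at \<open>m\<close>. Entry at any \<open>i\<close> is allowed,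
  as in scans that begin at a position \<open>a\<close>.\<close>

lemma runs_While:
  assumes "I i s" "i \<le> m"
    and body: "\<And>i s. I i s \<Longrightarrow> i < m \<Longrightarrow>
      bsafe B p s \<and> bval p s \<and> runs B c s T (I (Suc i))"
    and exit: "\<And>s. I m s \<Longrightarrow> bsafe B p s \<and> \<not> bval p s"
    and "m * (bcost p + 1 + T) + (bcost p + 1) \<le> t"
  shows "runs B (While p c) s t (I m)"
proof -
  have "runs B (While p c) s ((m - i) * (bcost p + 1 + T) + (bcost p + 1)) (I m)"
    using assms(2,1)
  proof (induction i arbitrary: s rule: inc_induct)
    case base
    then show ?case
      using exit[of s] exec.WhileFalse[of B p s c] unfolding runs_def by fastforce
  next
    case (step i)
    then obtain t1 s1 where 1: "exec B c s t1 s1" "t1 \<le> T" "I (Suc i) s1"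
      using body[of i s] by (auto simp: runs_def)
    obtain t2 s2 where 2: "exec B (While p c) s1 t2 s2" "I m s2"
      "t2 \<le> (m - Suc i) * (bcost p + 1 + T) + (bcost p + 1)"
      using step.IH[OF 1(3)] by (auto simp: runs_def)
    have "exec B (While p c) s (bcost p + 1 + t1 + t2) s2"
      by (rule exec.WhileTrue) (use body[of i s] step 1(1) 2(1) in auto)
    moreover have "(m - i) * (bcost p + 1 + T) = (bcost p + 1 + T) + (m - Suc i) * (bcost p + 1 + T)"
      using step.hyps by (metis Suc_diff_Suc mult_Suc)
    then have "bcost p + 1 + t1 + t2 \<le> (m - i) * (bcost p + 1 + T) + (bcost p + 1)"
      using 1(2) 2(3) by linarith
    ultimately show ?case using 2(2) unfolding runs_def by blast
  qed
  moreover have bound: "(m - i) * (bcost p + 1 + T) \<le> m * (bcost p + 1 + T)"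
    by (rule mult_le_mono1) simp
  ultimately show ?thesis
    by - (erule runs_weaken, use assms(5) in linarith)
qed

section \<open>The program\<close>

text \<open>
  For a level \<open>m\<close>: \<open>c[k]\<close> identifies the coset of the prefix of length \<open>k\<close>, \<open>S[k]\<close> that of the source of
  the edge at position \<open>k\<close>, and \<open>F[k]\<close> is the net number of traversals of this edge by the
  subword from \<open>a\<close> to \<open>b\<close>; \<open>z = 0\<close> iff all these numbers vanish. Once \<open>S\<close> is known, \<open>c\<close> can be overwritten by
  the cosets of level \<open>m + 1\<close>: the start \<open>a\<close> decreases, so the last value written is the least
  equivalent position.
\<close>

definition count_step :: com where
  "count_step =
     Seq (Cond (Conj (Equal (Lookup ''gen'' (V ''j'')) (Lookup ''gen'' (V ''b'')))
                     (Equal (Lookup ''S'' (V ''j'')) (Lookup ''S'' (V ''b''))))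
            (Update ''F'' (V ''j'') (Plus (Lookup ''F'' (V ''j'')) (Lookup ''sgn'' (V ''b''))))
            Skip)
    (Seq (Cond (Equal (Lookup ''F'' (V ''j'')) (N 0)) Skip (Assign ''z'' (N 1)))
         (Assign ''j'' (Plus (V ''j'') (N 1))))"

definition extend :: com where
  "extend =
     Seq (Seq (Assign ''z'' (N 0)) (Assign ''j'' (N 0)))
    (Seq (While (Less (V ''j'') (V ''n'')) count_step)
         (Seq (Cond (Equal (V ''z'') (N 0)) (Update ''c'' (Plus (V ''b'') (N 1)) (V ''a'')) Skip)
              (Assign ''b'' (Plus (V ''b'') (N 1)))))"

definition scan_from :: com where
  "scan_from =
     Seq (Seq (Assign ''a'' (Minus (V ''a'') (N 1)))
         (Seq (Update ''c'' (V ''a'') (V ''a'')) (Assign ''j'' (N 0))))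
    (Seq (While (Less (V ''j'') (V ''n''))
            (Seq (Update ''F'' (V ''j'') (N 0)) (Assign ''j'' (Plus (V ''j'') (N 1)))))
    (Seq (Assign ''b'' (V ''a''))
         (While (Less (V ''b'') (V ''n'')) extend)))"

definition level :: com where
  "level =
     Seq (Assign ''j'' (N 0))
    (Seq (While (Less (V ''j'') (V ''n''))
            (Seq (Cond (Equal (Lookup ''sgn'' (V ''j'')) (N 1))
                    (Update ''S'' (V ''j'') (Lookup ''c'' (V ''j'')))
                    (Update ''S'' (V ''j'') (Lookup ''c'' (Plus (V ''j'') (N 1)))))
                 (Assign ''j'' (Plus (V ''j'') (N 1)))))
    (Seq (Assign ''a'' (Plus (V ''n'') (N 1)))
    (Seq (While (Less (N 0) (V ''a'')) scan_from)
         (Assign ''m'' (Plus (V ''m'') (N 1))))))"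

text \<open>The empty word is answered at once: its time bound is a constant, which \<open>d\<close>
  rounds of the outer loop would exceed. The level \<open>m\<close> and the identifiers
  \<open>c\<close> rely on memory that is initially 0.\<close>

definition word_problem :: com where
  "word_problem =
     Cond (Equal (V ''n'') (N 0))
       (Assign ''out'' (N 1))
       (Seq (While (Less (V ''m'') (V ''d'')) level)
            (Cond (Equal (Lookup ''c'' (N 0)) (Lookup ''c'' (V ''n''))) (Assign ''out'' (N 1)) Skip))"

section \<open>Verification of the program over an abstract recursion\<close>

text \<open>These are the facts about free groups on which the verification rests: one class at
  level 0, and a recursion by net counts. Classes enter only through equality, hence the abstract
  type \<open>'v\<close>.\<close>

locale word_run =
  fixes r d n :: nat and gen sg :: "nat \<Rightarrow> int" and cls :: "nat \<Rightarrow> nat \<Rightarrow> 'v"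
  assumes r: "2 \<le> r" and d: "2 \<le> d"
    and gen: "k < n \<Longrightarrow> \<bar>gen k\<bar> \<le> int r"
    and sg: "k < n \<Longrightarrow> sg k = 1 \<or> sg k = -1"
    and cls_0: "cls 0 a = cls 0 b"
    and cls_Suc: "a \<le> b \<Longrightarrow> b \<le> n \<Longrightarrow> cls (Suc m) a = cls (Suc m) b \<longleftrightarrow>
      (\<forall>j<n. (\<Sum>k\<in>{a..<b}. if gen k = gen j \<and>
          cls m (if sg k = 1 then k else Suc k) = cls m (if sg j = 1 then j else Suc j)
        then sg k else 0) = 0)"
begin

definition src :: "nat \<Rightarrow> nat \<Rightarrow> 'v" where
  "src m k = cls m (if sg k = 1 then k else Suc k)"

definition net :: "nat \<Rightarrow> nat \<Rightarrow> nat \<Rightarrow> nat \<Rightarrow> int" where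
  "net m a b j = (\<Sum>k\<in>{a..<b}. if gen k = gen j \<and> src m k = src m j then sg k else 0)"

text \<open>Generators are at most \<open>r\<close>, levels at most \<open>d\<close>, identifiers
  and absolute counts at most \<open>n\<close>, and the largest position formed is
  \<open>n + 1\<close>.\<close>

abbreviation B :: int where "B \<equiv> int (r + d + n)"

definition base :: "nat \<Rightarrow> store \<Rightarrow> bool" where
  "base m s \<longleftrightarrow> vars s ''n'' = int n \<and> vars s ''d'' = int d \<and> vars s ''m'' = int m \<and>
     vars s ''out'' = 0 \<and>
     (\<forall>k<n. arrays s ''gen'' (int k) = gen k \<and> arrays s ''sgn'' (int k) = sg k)"

text \<open>Only positions from \<open>a\<close> on are constrained, because a level rewrites
  \<open>c\<close> from the right. The lower bound \<open>a\<close> on the identifiers leaves the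
  next smaller position as a fresh identifier.\<close>

definition class_ids :: "nat \<Rightarrow> nat \<Rightarrow> store \<Rightarrow> bool" where
  "class_ids a m s \<longleftrightarrow>
     (\<forall>k\<in>{a..n}. int a \<le> arrays s ''c'' (int k) \<and> arrays s ''c'' (int k) \<le> int n) \<and>
     (\<forall>k\<in>{a..n}. \<forall>l\<in>{a..n}.
        arrays s ''c'' (int k) = arrays s ''c'' (int l) \<longleftrightarrow> cls m k = cls m l)"

definition source_ids :: "nat \<Rightarrow> store \<Rightarrow> bool" where
  "source_ids m s \<longleftrightarrow>
     (\<forall>k<n. 0 \<le> arrays s ''S'' (int k) \<and> arrays s ''S'' (int k) \<le> int n) \<and>
     (\<forall>k<n. \<forall>l<n. arrays s ''S'' (int k) = arrays s ''S'' (int l) \<longleftrightarrow> src m k = src m l)"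

lemma net_Suc:
  "a \<le> b \<Longrightarrow>
   net m a (Suc b) j = net m a b j + (if gen b = gen j \<and> src m b = src m j then sg b else 0)"
  by (simp add: net_def)

lemma net_bound:
  assumes "a \<le> b" "b \<le> n"
  shows "\<bar>net m a b j\<bar> \<le> int (b - a)"
proof -
  have "\<bar>net m a b j\<bar> \<le> (\<Sum>k\<in>{a..<b}. 1)"
    unfolding net_def
  proof (rule order_trans[OF sum_abs], rule sum_mono)
    fix k assume "k \<in> {a..<b}"
    then show "\<bar>if gen k = gen j \<and> src m k = src m j then sg k else 0\<bar> \<le> 1"
      using sg[of k] assms by auto
  qed
  then show ?thesis using assms by simp
qed

text \<open>Moving the end from \<open>b\<close> to \<open>Suc b\<close> changes only the counters
  of positions with the same edge as \<open>b\<close>. One linear pass updates them and raises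
  \<open>z\<close> at the first nonzero count; \<open>C\<close> records that \<open>c\<close> stays
  untouched.\<close>

lemma count_loop:
  assumes "a \<le> b" "b < n" "m \<le> d"
    and "base m s" "source_ids m s" "vars s ''a'' = int a" "vars s ''b'' = int b"
    and "vars s ''j'' = 0" "vars s ''z'' = 0"
    and "\<And>k. k < n \<Longrightarrow> arrays s ''F'' (int k) = net m a b k"
    and "\<And>k. k \<le> n \<Longrightarrow> arrays s ''c'' (int k) = C k"
  shows "runs B (While (Less (V ''j'') (V ''n'')) count_step) s (60 * (n + 1))
    (\<lambda>s. base m s \<and> source_ids m s \<and> vars s ''a'' = int a \<and> vars s ''b'' = int b \<and>
      (vars s ''z'' = 0 \<longleftrightarrow> (\<forall>k<n. net m a (Suc b) k = 0)) \<and> \<bar>vars s ''z''\<bar> \<le> 1 \<and>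
      (\<forall>k<n. arrays s ''F'' (int k) = net m a (Suc b) k) \<and>
      (\<forall>k\<le>n. arrays s ''c'' (int k) = C k))"
proof -
  define I where "I i s \<longleftrightarrow> base m s \<and> source_ids m s \<and> vars s ''a'' = int a \<and> vars s ''b'' = int b \<and>
      vars s ''j'' = int i \<and> i \<le> n \<and>
      (vars s ''z'' = 0 \<longleftrightarrow> (\<forall>k<i. net m a (Suc b) k = 0)) \<and> \<bar>vars s ''z''\<bar> \<le> 1 \<and>
      (\<forall>k<n. arrays s ''F'' (int k) = (if k < i then net m a (Suc b) k else net m a b k)) \<and>
      (\<forall>k\<le>n. arrays s ''c'' (int k) = C k)" for i s
  have "runs B (While (Less (V ''j'') (V ''n'')) count_step) s (60 * (n + 1)) (I n)"
  proof (rule runs_While)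
    show "I 0 s" using assms by (simp add: I_def)
  next
    fix i s assume I: "I i s" and i: "i < n"
    note nb = net_bound[of a b m i] net_bound[of a "Suc b" m i] net_Suc[of a b m i]
    have s: "arrays s ''S'' (int i) = arrays s ''S'' (int b) \<longleftrightarrow> src m b = src m i"
      "\<bar>arrays s ''S'' (int i)\<bar> \<le> int n" "\<bar>arrays s ''S'' (int b)\<bar> \<le> int n"
      using I i assms(2) by (auto simp: I_def source_ids_def)
    have g: "arrays s ''gen'' (int i) = gen i" "arrays s ''gen'' (int b) = gen b"
      "arrays s ''sgn'' (int b) = sg b" "vars s ''n'' = int n"
      using I i assms(2) by (auto simp: I_def base_def)
    have v: "vars s ''j'' = int i" "vars s ''b'' = int b" "arrays s ''F'' (int i) = net m a b i"
      using I i by (auto simp: I_def)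
    define f where "f = net m a (Suc b) i"
    \<comment> \<open>One explicit final store for both branches: if the edges differ,
      \<open>f\<close> is the old count and the update of \<open>F\<close> changes nothing.\<close>
    define s' where "s' = s\<lparr>
      arrays := (arrays s)(''F'' := (arrays s ''F'')(int i := f)),
      vars := (vars s)(''z'' := (if f = 0 then vars s ''z'' else 1), ''j'' := int i + 1)\<rparr>"
    have f: "f = net m a b i + (if gen i = gen b \<and> src m b = src m i then sg b else 0)"
      using assms(1) by (auto simp: f_def net_Suc)
    have bounds: "\<bar>net m a b i\<bar> \<le> int n" "\<bar>f\<bar> \<le> int n" "\<bar>gen i\<bar> \<le> int r" "\<bar>gen b\<bar> \<le> int r" "\<bar>sg b\<bar> \<le> 1"
      using net_bound[of a b m i] net_bound[of a "Suc b" m i] gen[OF i] gen[OF assms(2)]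
        sg[OF assms(2)] assms(1,2) by (auto simp: f_def)
    have "wp B count_step (\<lambda>s. s = s') s"
    proof (cases "gen i = gen b \<and> src m b = src m i")
      case True
      then show ?thesis
        using f bounds assms(1-3) i r d s(2,3) by (simp add: count_step_def s(1) g v s'_def)
    next
      case False
      then have nf: "net m a b i = f" by (auto simp: f)
      then have upd: "(arrays s ''F'')(int i := f) = arrays s ''F''"
        using v(3) by (simp add: fun_upd_idem)
      show ?thesis
        using False bounds assms(1-3) i r d s(2,3)
        by (auto simp: count_step_def s(1) g v nf upd s'_def)
    qed
    moreover have "I (Suc i) s'"
      using I i by (auto simp: I_def s'_def base_def source_ids_def f_def less_Suc_eq)
    ultimately have "wp B count_step (I (Suc i)) s" by (auto elim: wp_mono)
    then show "bsafe B (Less (V ''j'') (V ''n'')) s \<and> bval (Less (V ''j'') (V ''n'')) s \<and>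
        runs B count_step s (ccost count_step) (I (Suc i))"
      using i wp_runs by (simp add: g v)
  next
    fix s assume "I n s"
    then show "bsafe B (Less (V ''j'') (V ''n'')) s \<and> \<not> bval (Less (V ''j'') (V ''n'')) s"
      by (simp add: I_def base_def)
  qed (simp_all add: count_step_def)
  then show ?thesis
    by (rule runs_weaken) (simp_all add: I_def)
qed

text \<open>\<open>C\<close> freezes the contents of \<open>c\<close> at the beginning of the scan,
  after \<open>a\<close> has been labelled by itself.\<close>

definition scanned :: "nat \<Rightarrow> nat \<Rightarrow> (nat \<Rightarrow> int) \<Rightarrow> nat \<Rightarrow> store \<Rightarrow> bool" where
  "scanned m a C b s \<longleftrightarrow> base m s \<and> source_ids m s \<and> vars s ''a'' = int a \<and> vars s ''b'' = int b \<and>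
     (\<forall>k<n. arrays s ''F'' (int k) = net m a b k) \<and>
     (\<forall>k\<le>n. arrays s ''c'' (int k) =
        (if a \<le> k \<and> k \<le> b \<and> cls (Suc m) a = cls (Suc m) k then int a else C k))"

lemma runs_extend:
  assumes "a \<le> b" "b < n" "m \<le> d" "scanned m a C b s"
  shows "runs B extend s (100 * (n + 1)) (scanned m a C (Suc b))"
  unfolding extend_def
proof (rule runs_Seq)
  let ?C = "\<lambda>k. if a \<le> k \<and> k \<le> b \<and> cls (Suc m) a = cls (Suc m) k then int a else C k"
  let ?P = "\<lambda>s. scanned m a C b s \<and> vars s ''z'' = 0 \<and> vars s ''j'' = 0"
  let ?R = "\<lambda>s. base m s \<and> source_ids m s \<and> vars s ''a'' = int a \<and> vars s ''b'' = int b \<and>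
      (vars s ''z'' = 0 \<longleftrightarrow> (\<forall>k<n. net m a (Suc b) k = 0)) \<and> \<bar>vars s ''z''\<bar> \<le> 1 \<and>
      (\<forall>k<n. arrays s ''F'' (int k) = net m a (Suc b) k) \<and>
      (\<forall>k\<le>n. arrays s ''c'' (int k) = ?C k)"
  show "runs B (Seq (Assign ''z'' (N 0)) (Assign ''j'' (N 0))) s 4 ?P"
    by (rule runs_wp) (use assms in \<open>simp_all add: scanned_def base_def source_ids_def\<close>)
  fix s assume P: "?P s"
  show "runs B (Seq (While (Less (V ''j'') (V ''n'')) count_step)
         (Seq (Cond (Equal (V ''z'') (N 0)) (Update ''c'' (Plus (V ''b'') (N 1)) (V ''a'')) Skip)
              (Assign ''b'' (Plus (V ''b'') (N 1))))) s (60 * (n + 1) + 20) (scanned m a C (Suc b))"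
  proof (rule runs_Seq)
    show "runs B (While (Less (V ''j'') (V ''n'')) count_step) s (60 * (n + 1)) ?R"
      by (rule count_loop) (use assms(1-3) P in \<open>simp_all add: scanned_def\<close>)
    fix s assume R: "?R s"
    \<comment> \<open>The recursion for the pair \<open>a\<close>, \<open>Suc b\<close>: all counts
      vanish iff the two positions are equivalent at the next level.\<close>
    have z: "vars s ''z'' = 0 \<longleftrightarrow> cls (Suc m) a = cls (Suc m) (Suc b)"
      using R assms cls_Suc[of a "Suc b" m] by (simp add: net_def src_def)
    have v: "vars s ''a'' = int a" "vars s ''b'' = int b" "\<bar>vars s ''z''\<bar> \<le> 1"
      using R by simp_all
    have C: "arrays s ''c'' (int k) = ?C k" if "k \<le> n" for k
      using R that by simp
    have idx: "int k = int b + 1 \<longleftrightarrow> k = Suc b" for k by auto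
    have "scanned m a C (Suc b)
      (s\<lparr>arrays := (arrays s)(''c'' := (arrays s ''c'')(int b + 1 := int a)),
         vars := (vars s)(''b'' := int b + 1)\<rparr>)" if "cls (Suc m) a = cls (Suc m) (Suc b)"
      using R C that assms(1,2)
      by (auto simp: scanned_def base_def source_ids_def le_Suc_eq idx)
    moreover have "scanned m a C (Suc b) (s\<lparr>vars := (vars s)(''b'' := int b + 1)\<rparr>)"
      if "cls (Suc m) a \<noteq> cls (Suc m) (Suc b)"
      using R C that assms(1,2)
      by (auto simp: scanned_def base_def source_ids_def le_Suc_eq)
    ultimately have "wp B (Seq (Cond (Equal (V ''z'') (N 0)) (Update ''c'' (Plus (V ''b'') (N 1)) (V ''a'')) Skip)
        (Assign ''b'' (Plus (V ''b'') (N 1)))) (scanned m a C (Suc b)) s"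
      using v z assms(1,2) by auto
    then show "runs B (Seq (Cond (Equal (V ''z'') (N 0)) (Update ''c'' (Plus (V ''b'') (N 1)) (V ''a'')) Skip)
        (Assign ''b'' (Plus (V ''b'') (N 1)))) s 20 (scanned m a C (Suc b))"
      by (rule runs_wp) simp
  qed simp
qed simp

lemma reset_loop:
  assumes "base m s" "source_ids m s" "vars s ''a'' = int a" "vars s ''j'' = 0"
    and "\<And>k. k \<le> n \<Longrightarrow> arrays s ''c'' (int k) = C k"
  shows "runs B (While (Less (V ''j'') (V ''n''))
      (Seq (Update ''F'' (V ''j'') (N 0)) (Assign ''j'' (Plus (V ''j'') (N 1))))) s (20 * (n + 1))
    (\<lambda>s. base m s \<and> source_ids m s \<and> vars s ''a'' = int a \<and>
      (\<forall>k<n. arrays s ''F'' (int k) = 0) \<and> (\<forall>k\<le>n. arrays s ''c'' (int k) = C k))"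
proof -
  define I where "I i s \<longleftrightarrow> base m s \<and> source_ids m s \<and> vars s ''a'' = int a \<and>
      vars s ''j'' = int i \<and> (\<forall>k<i. arrays s ''F'' (int k) = 0) \<and>
      (\<forall>k\<le>n. arrays s ''c'' (int k) = C k)" for i s
  let ?c = "Seq (Update ''F'' (V ''j'') (N 0)) (Assign ''j'' (Plus (V ''j'') (N 1)))"
  have "runs B (While (Less (V ''j'') (V ''n'')) ?c) s (20 * (n + 1)) (I n)"
  proof (rule runs_While)
    show "I 0 s" using assms by (simp add: I_def)
  next
    fix i s assume I: "I i s" and i: "i < n"
    then have "wp B ?c (I (Suc i)) s"
      using r by (auto simp: I_def base_def source_ids_def less_Suc_eq)
    moreover have "bsafe B (Less (V ''j'') (V ''n'')) s \<and> bval (Less (V ''j'') (V ''n'')) s"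
      using I i by (simp add: I_def base_def)
    ultimately show "bsafe B (Less (V ''j'') (V ''n'')) s \<and> bval (Less (V ''j'') (V ''n'')) s \<and>
        runs B ?c s (ccost ?c) (I (Suc i))"
      using wp_runs by blast
  qed (simp_all add: I_def base_def)
  then show ?thesis
    by (rule runs_weaken) (simp_all add: I_def)
qed

text \<open>All identifiers in force are at least \<open>Suc a\<close>, so \<open>a\<close> is
  fresh. The class of \<open>a\<close> is relabelled as a whole and the other classes keep their
  identifiers.\<close>

lemma runs_scan_from:
  assumes "a \<le> n" "m \<le> d" "base m s" "source_ids m s" "vars s ''a'' = int (Suc a)"
    and "class_ids (Suc a) (Suc m) s"
  shows "runs B scan_from s (160 * (n + 1) ^ 2)
    (\<lambda>s. base m s \<and> source_ids m s \<and> vars s ''a'' = int a \<and> class_ids a (Suc m) s)"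
  unfolding scan_from_def
proof (rule runs_Seq)
  define C where "C k = (if k = a then int a else arrays s ''c'' (int k))" for k
  let ?P = "\<lambda>s. base m s \<and> source_ids m s \<and> vars s ''a'' = int a \<and> vars s ''j'' = 0 \<and>
    (\<forall>k\<le>n. arrays s ''c'' (int k) = C k)"
  let ?R = "\<lambda>s. base m s \<and> source_ids m s \<and> vars s ''a'' = int a \<and>
    (\<forall>k<n. arrays s ''F'' (int k) = 0) \<and> (\<forall>k\<le>n. arrays s ''c'' (int k) = C k)"
  have C: "\<forall>k\<in>{Suc a..n}. int (Suc a) \<le> C k \<and> C k \<le> int n"
    "\<forall>k\<in>{Suc a..n}. \<forall>l\<in>{Suc a..n}. C k = C l \<longleftrightarrow> cls (Suc m) k = cls (Suc m) l"
    using assms(6) by (auto simp: C_def class_ids_def)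
  show "runs B (Seq (Assign ''a'' (Minus (V ''a'') (N 1)))
         (Seq (Update ''c'' (V ''a'') (V ''a'')) (Assign ''j'' (N 0)))) s 20 ?P"
    by (rule runs_wp) (use assms r in \<open>auto simp: base_def source_ids_def C_def\<close>)
  fix s assume P: "?P s"
  show "runs B (Seq (While (Less (V ''j'') (V ''n''))
            (Seq (Update ''F'' (V ''j'') (N 0)) (Assign ''j'' (Plus (V ''j'') (N 1)))))
    (Seq (Assign ''b'' (V ''a''))
         (While (Less (V ''b'') (V ''n'')) extend))) s (20 * (n + 1) + (2 + 110 * (n + 1) ^ 2))
    (\<lambda>s. base m s \<and> source_ids m s \<and> vars s ''a'' = int a \<and> class_ids a (Suc m) s)"
  proof (rule runs_Seq[OF reset_loop])
    fix s assume R: "?R s"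
    show "runs B (Seq (Assign ''b'' (V ''a'')) (While (Less (V ''b'') (V ''n'')) extend)) s
      (2 + 110 * (n + 1) ^ 2)
      (\<lambda>s. base m s \<and> source_ids m s \<and> vars s ''a'' = int a \<and> class_ids a (Suc m) s)"
    proof (rule runs_Seq)
      show "runs B (Assign ''b'' (V ''a'')) s 2 (scanned m a C a)"
        by (rule runs_wp) (use R assms(1) in
          \<open>auto simp: scanned_def base_def source_ids_def C_def net_def\<close>)
      fix s assume S: "scanned m a C a s"
      define I where "I b s \<longleftrightarrow> a \<le> b \<and> scanned m a C b s" for b s
      have "runs B (While (Less (V ''b'') (V ''n'')) extend) s (110 * (n + 1) ^ 2) (I n)"
      proof (rule runs_While)
        show "I a s" using S by (simp add: I_def)
      next
        fix b s assume I: "I b s" and b: "b < n"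
        have "runs B extend s (100 * (n + 1)) (scanned m a C (Suc b))"
          by (rule runs_extend) (use I b assms(2) in \<open>simp_all add: I_def\<close>)
        then have "runs B extend s (100 * (n + 1)) (I (Suc b))"
          by (rule runs_weaken) (use I in \<open>simp_all add: I_def\<close>)
        then show "bsafe B (Less (V ''b'') (V ''n'')) s \<and> bval (Less (V ''b'') (V ''n'')) s \<and>
            runs B extend s (100 * (n + 1)) (I (Suc b))"
          using I b by (simp add: I_def scanned_def base_def del: mult_Suc_right)
      qed (use assms(1) in \<open>simp_all add: I_def scanned_def base_def power2_eq_square algebra_simps\<close>)
      then show "runs B (While (Less (V ''b'') (V ''n'')) extend) s (110 * (n + 1) ^ 2)
        (\<lambda>s. base m s \<and> source_ids m s \<and> vars s ''a'' = int a \<and> class_ids a (Suc m) s)"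
      proof (rule runs_weaken)
        fix s assume "I n s"
        then have s: "base m s" "source_ids m s" "vars s ''a'' = int a"
          and c: "\<And>k. k \<in> {a..n} \<Longrightarrow> arrays s ''c'' (int k) =
            (if cls (Suc m) a = cls (Suc m) k then int a else C k)"
          by (auto simp: I_def scanned_def)
        \<comment> \<open>A position outside the class of \<open>a\<close> differs from
          \<open>a\<close>, so its identifier is an old one and exceeds \<open>a\<close>.\<close>
        have Ca: "int a < C k \<and> C k \<le> int n" if "k \<in> {a..n}" "cls (Suc m) a \<noteq> cls (Suc m) k" for k
        proof -
          have "k \<in> {Suc a..n}" using that by (cases "k = a") auto
          then show ?thesis using C(1) by force
        qed
        have CC: "C k = C l \<longleftrightarrow> cls (Suc m) k = cls (Suc m) l"
          if "k \<in> {a..n}" "cls (Suc m) a \<noteq> cls (Suc m) k"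
            "l \<in> {a..n}" "cls (Suc m) a \<noteq> cls (Suc m) l" for k l
        proof -
          have "k \<in> {Suc a..n}" "l \<in> {Suc a..n}"
            using that by (cases "k = a"; cases "l = a"; auto)+
          then show ?thesis using C(2) by blast
        qed
        have "class_ids a (Suc m) s"
          unfolding class_ids_def
        proof (intro conjI ballI)
          fix k assume k: "k \<in> {a..n}"
          show "int a \<le> arrays s ''c'' (int k)" "arrays s ''c'' (int k) \<le> int n"
            using Ca[OF k] k assms(1) by (auto simp: c)
        next
          fix k l assume k: "k \<in> {a..n}" and l: "l \<in> {a..n}"
          show "arrays s ''c'' (int k) = arrays s ''c'' (int l) \<longleftrightarrow> cls (Suc m) k = cls (Suc m) l"
            using Ca[OF k] Ca[OF l] CC[OF k _ l] c[OF k] c[OF l] by auto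
        qed
        with s show "base m s \<and> source_ids m s \<and> vars s ''a'' = int a \<and> class_ids a (Suc m) s"
          by simp
      qed simp
    qed simp
  qed (use P in simp_all)
qed (simp add: power2_eq_square algebra_simps)

text \<open>The source for an inverse letter is the vertex after it, so identifiers are read up to
  position \<open>n\<close>.\<close>

lemma source_loop:
  assumes "base m s" "class_ids 0 m s" "vars s ''j'' = 0"
  shows "runs B (While (Less (V ''j'') (V ''n''))
            (Seq (Cond (Equal (Lookup ''sgn'' (V ''j'')) (N 1))
                    (Update ''S'' (V ''j'') (Lookup ''c'' (V ''j'')))
                    (Update ''S'' (V ''j'') (Lookup ''c'' (Plus (V ''j'') (N 1)))))
                 (Assign ''j'' (Plus (V ''j'') (N 1))))) s (40 * (n + 1))
    (\<lambda>s. base m s \<and> source_ids m s)"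
    (is "runs B (While ?p ?c) s _ _")
proof -
  define C where "C k = arrays s ''c'' (int k)" for k
  have C: "\<forall>k\<le>n. 0 \<le> C k \<and> C k \<le> int n"
    "\<forall>k\<le>n. \<forall>l\<le>n. C k = C l \<longleftrightarrow> cls m k = cls m l"
    using assms(2) by (auto simp: C_def class_ids_def)
  define I where "I i s \<longleftrightarrow> base m s \<and> vars s ''j'' = int i \<and>
      (\<forall>k<i. arrays s ''S'' (int k) = C (if sg k = 1 then k else Suc k)) \<and>
      (\<forall>k\<le>n. arrays s ''c'' (int k) = C k)" for i s
  have "runs B (While ?p ?c) s (40 * (n + 1)) (I n)"
  proof (rule runs_While)
    show "I 0 s" using assms by (simp add: I_def C_def)
  next
    fix i s assume I: "I i s" and i: "i < n"
    have c: "arrays s ''c'' (int i) = C i" "arrays s ''c'' (int i + 1) = C (Suc i)"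
      using I i by (auto simp: I_def dest: spec[of _ "Suc i"] simp: add.commute)
    have v: "vars s ''j'' = int i" "vars s ''n'' = int n" "arrays s ''sgn'' (int i) = sg i"
      using I i by (auto simp: I_def base_def)
    have bounds: "\<bar>C i\<bar> \<le> int n" "\<bar>C (Suc i)\<bar> \<le> int n" "\<bar>sg i\<bar> \<le> 1"
      using C(1) i sg[OF i] by (auto simp: Suc_le_eq)
    have "wp B ?c (I (Suc i)) s"
    proof (cases "sg i = 1")
      case True
      have "I (Suc i) (s\<lparr>arrays := (arrays s)(''S'' := (arrays s ''S'')(int i := C i)),
          vars := (vars s)(''j'' := int i + 1)\<rparr>)"
        using I i True by (auto simp: I_def base_def less_Suc_eq)
      then show ?thesis using True bounds r i by (simp add: c v)
    next
      case False
      have "I (Suc i) (s\<lparr>arrays := (arrays s)(''S'' := (arrays s ''S'')(int i := C (Suc i))),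
          vars := (vars s)(''j'' := int i + 1)\<rparr>)"
        using I i False by (auto simp: I_def base_def less_Suc_eq)
      then show ?thesis using False bounds r i by (simp add: c v)
    qed
    moreover have "bsafe B ?p s \<and> bval ?p s"
      using i by (simp add: v)
    ultimately show "bsafe B ?p s \<and> bval ?p s \<and> runs B ?c s (ccost ?c) (I (Suc i))"
      using wp_runs by blast
  qed (simp_all add: I_def base_def)
  then show ?thesis
  proof (rule runs_weaken)
    fix s assume I: "I n s"
    have S: "arrays s ''S'' (int k) = C (if sg k = 1 then k else Suc k)"
      "(if sg k = 1 then k else Suc k) \<le> n" if "k < n" for k
      using I that by (auto simp: I_def)
    have "source_ids m s"
      unfolding source_ids_def src_def using C S by (simp del: if_split)
    with I show "base m s \<and> source_ids m s" by (simp add: I_def)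
  qed simp
qed

lemma runs_level:
  assumes "m < d" "base m s" "class_ids 0 m s"
  shows "runs B level s (250 * (n + 1) ^ 3) (\<lambda>s. base (Suc m) s \<and> class_ids 0 (Suc m) s)"
  unfolding level_def
proof (rule runs_Seq)
  let ?P = "\<lambda>s. base m s \<and> class_ids 0 m s \<and> vars s ''j'' = 0"
  show "runs B (Assign ''j'' (N 0)) s 2 ?P"
    by (rule runs_wp) (use assms in \<open>simp_all add: base_def class_ids_def\<close>)
  fix s assume P: "?P s"
  \<comment> \<open>\<open>i\<close> counts the finished starts. For \<open>i = 0\<close> the
    condition on \<open>c\<close> is empty, so the old identifiers may stay in place. There are
    \<open>n + 1\<close> starts of quadratic cost each.\<close>
  define I where "I i s \<longleftrightarrow> base m s \<and> source_ids m s \<and> i \<le> n + 1 \<and> vars s ''a'' = int (n + 1 - i) \<and>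
    class_ids (n + 1 - i) (Suc m) s" for i s
  let ?Q = "\<lambda>s. base (Suc m) s \<and> class_ids 0 (Suc m) s"
  let ?c2 = "Seq (While (Less (N 0) (V ''a'')) scan_from) (Assign ''m'' (Plus (V ''m'') (N 1)))"
  let ?c1 = "Seq (Assign ''a'' (Plus (V ''n'') (N 1))) ?c2"
  show "runs B (Seq (While (Less (V ''j'') (V ''n''))
            (Seq (Cond (Equal (Lookup ''sgn'' (V ''j'')) (N 1))
                    (Update ''S'' (V ''j'') (Lookup ''c'' (V ''j'')))
                    (Update ''S'' (V ''j'') (Lookup ''c'' (Plus (V ''j'') (N 1)))))
                 (Assign ''j'' (Plus (V ''j'') (N 1))))) ?c1) s
      (40 * (n + 1) + (4 + (170 * (n + 1) ^ 3 + 4))) ?Q"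
  proof (rule runs_Seq[OF source_loop])
    fix s assume S: "base m s \<and> source_ids m s"
    show "runs B ?c1 s (4 + (170 * (n + 1) ^ 3 + 4)) ?Q"
    proof (rule runs_Seq)
      show "runs B (Assign ''a'' (Plus (V ''n'') (N 1))) s 4 (I 0)"
        by (rule runs_wp) (use S r in \<open>simp_all add: I_def base_def source_ids_def class_ids_def\<close>)
      fix s assume I0: "I 0 s"
      show "runs B ?c2 s (170 * (n + 1) ^ 3 + 4) ?Q"
      proof (rule runs_Seq)
        show "runs B (While (Less (N 0) (V ''a'')) scan_from) s (170 * (n + 1) ^ 3) (I (n + 1))"
        proof (rule runs_While[of I 0, OF I0])
          fix i s assume I: "I i s" and i: "i < n + 1"
          have "runs B scan_from s (160 * (n + 1) ^ 2)
            (\<lambda>s. base m s \<and> source_ids m s \<and> vars s ''a'' = int (n - i) \<and> class_ids (n - i) (Suc m) s)"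
            by (rule runs_scan_from) (use I i assms(1) in \<open>simp_all add: I_def Suc_diff_le\<close>)
          then have "runs B scan_from s (160 * (n + 1) ^ 2) (I (Suc i))"
            by (rule runs_weaken) (use i in \<open>simp_all add: I_def\<close>)
          then show "bsafe B (Less (N 0) (V ''a'')) s \<and> bval (Less (N 0) (V ''a'')) s \<and>
              runs B scan_from s (160 * (n + 1) ^ 2) (I (Suc i))"
            using I i r by (auto simp: I_def)
        qed (simp_all add: I_def power2_eq_square power3_eq_cube algebra_simps)
        fix s assume "I (n + 1) s"
        then show "runs B (Assign ''m'' (Plus (V ''m'') (N 1))) s 4 ?Q"
          by (intro runs_wp) (use assms(1) r in \<open>simp_all add: I_def base_def class_ids_def\<close>)
      qed simp
    qed simp
  qed (use P in simp_all)
qed (simp add: power3_eq_cube algebra_simps)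

lemma runs_word_problem:
  assumes "0 < n" "base 0 s" "\<And>k. k \<le> n \<Longrightarrow> arrays s ''c'' (int k) = 0"
  shows "runs B word_problem s (300 * d * (n + 1) ^ 3)
    (\<lambda>s. vars s ''out'' = (if cls d 0 = cls d n then 1 else 0))"
proof -
  let ?c1 = "While (Less (V ''m'') (V ''d'')) level"
  let ?c2 = "Cond (Equal (Lookup ''c'' (N 0)) (Lookup ''c'' (V ''n''))) (Assign ''out'' (N 1)) Skip"
  let ?Q = "\<lambda>s. vars s ''out'' = (if cls d 0 = cls d n then 1 else 0)"
  define I where "I m s \<longleftrightarrow> base m s \<and> class_ids 0 m s" for m s
  have "runs B (Seq ?c1 ?c2) s (260 * d * (n + 1) ^ 3 + 20) ?Q"
  proof (rule runs_Seq)
    show "runs B ?c1 s (260 * d * (n + 1) ^ 3) (I d)"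
    proof (rule runs_While)
      \<comment> \<open>The zero array encodes level 0, where all prefixes form one class.\<close>
      show "I 0 s" using assms cls_0 by (simp add: I_def class_ids_def)
    next
      fix m s assume I: "I m s" and m: "m < d"
      then show "bsafe B (Less (V ''m'') (V ''d'')) s \<and> bval (Less (V ''m'') (V ''d'')) s \<and>
          runs B level s (250 * (n + 1) ^ 3) (I (Suc m))"
        using runs_level[OF m, of s] unfolding I_def by (simp add: base_def)
    qed (use d in \<open>simp_all add: I_def base_def power3_eq_cube algebra_simps\<close>)
    fix s assume I: "I d s"
    have C: "0 \<le> arrays s ''c'' (int k) \<and> arrays s ''c'' (int k) \<le> int n"
      "arrays s ''c'' (int k) = arrays s ''c'' (int l) \<longleftrightarrow> cls d k = cls d l"
      if "k \<le> n" "l \<le> n" for k l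
      using I that by (auto simp: I_def class_ids_def)
    have "vars s ''n'' = int n" "vars s ''out'' = 0"
      using I by (auto simp: I_def base_def)
    then show "runs B ?c2 s 20 ?Q"
      by (intro runs_wp) (use r C[of 0 n] C[of n 0] in simp_all)
  qed simp
  then obtain t s' where e: "exec B (Seq ?c1 ?c2) s t s'" "t \<le> 260 * d * (n + 1) ^ 3 + 20" "?Q s'"
    by (auto simp: runs_def)
  \<comment> \<open>The outer conditional contains a loop, which \<open>wp\<close> does not treat,
    so this last step of the execution is built by hand.\<close>
  have "exec B word_problem s (bcost (Equal (V ''n'') (N 0)) + 1 + t) s'"
    unfolding word_problem_def
    by (rule exec.CondFalse) (use assms e(1) in \<open>simp_all add: base_def\<close>)
  moreover have "bcost (Equal (V ''n'') (N 0)) + 1 + t \<le> 300 * d * (n + 1) ^ 3"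
  proof -
    \<comment> \<open>The additive costs, 24 in all, fit into the slack of 40 because the product is
      at least 1.\<close>
    have "1 \<le> d * (n + 1) ^ 3" using d by simp
    moreover have "t \<le> 260 * (d * (n + 1) ^ 3) + 20" using e(2) by (simp only: mult.assoc)
    ultimately have "4 + t \<le> 300 * (d * (n + 1) ^ 3)" by linarith
    then show ?thesis by (simp add: mult.assoc)
  qed
  ultimately show ?thesis using e(3) unfolding runs_def by blast
qed

end

section \<open>The uniform time bound\<close>

theorem theorem3p11:
  "\<exists>(prog :: com) (K :: nat) (C :: nat).
     \<forall>(r :: nat) (d :: nat) (w :: word).
       2 \<le> r \<longrightarrow> 2 \<le> d \<longrightarrow> w \<in> words r \<longrightarrow>
       (\<exists>(t :: nat) (s :: store).
          exec (int (K * (r + d + length w))) prog (input_store r d w) t s \<and>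
          t \<le> C * (d * r * length w ^ 3 + 1) \<and>
          vars s ''out'' = (if word_class r d w = \<one>\<^bsub>free_solvable_group r d\<^esub> then 1 else 0))"
\<comment> \<open>The value bound is \<open>r + d + length w\<close> itself. The constant 2400 is
  300 times 8, where 8 pays for replacing \<open>length w + 1\<close> by
  \<open>2 * length w\<close>.\<close>
proof (rule exI[of _ word_problem], rule exI[of _ 1], rule exI[of _ 2400], intro allI impI)
  fix r d :: nat and w :: word
  assume r: "2 \<le> r" and d: "2 \<le> d" and w: "w \<in> words r"
  let ?B = "int (1 * (r + d + length w))"
  let ?out = "if word_class r d w = \<one>\<^bsub>free_solvable_group r d\<^esub> then 1 else 0 :: int"
  have "\<exists>t s. exec ?B word_problem (input_store r d w) t s \<and> t \<le> 2400 * (d * r * length w ^ 3 + 1) \<and>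
      vars s ''out'' = ?out"
  \<comment> \<open>For the empty word the cubic term vanishes and the additive 1 of the bound has
    to cover the run.\<close>
  proof (cases "w = []")
    case True
    then have "?out = 1" by (simp add: word_class_eq_one_iff)
    moreover have "exec ?B word_problem (input_store r d w) (bcost (Equal (V ''n'') (N 0)) + 1 + 2)
        (input_store r d w\<lparr>vars := (vars (input_store r d w))(''out'' := 1)\<rparr>)"
      unfolding word_problem_def
      using exec.Assign[of ?B "N 1" "input_store r d w" "''out''"] r True
      by (intro exec.CondTrue) (simp_all add: input_store_def numeral_2_eq_2)
    ultimately show ?thesis by (intro exI conjI) auto
  next
    case False
    define cls where "cls m k = derived_term r m #>\<^bsub>free_group r\<^esub> reduce (take k w)" for m k
    interpret word_run r d "length w" "\<lambda>k. int (fst (w ! k))" "\<lambda>k. if snd (w ! k) then 1 else -1" cls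
    proof
      fix a b m :: nat
      interpret group "free_group r" by (rule group_free_group)
      \<comment> \<open>At level 0 the subgroup is the whole free group, which has a single
        coset.\<close>
      have "cls 0 k = carrier (free_group r)" for k
      proof -
        have "take k w \<in> words r" using w by (auto simp: words_def dest: in_set_takeD)
        then show ?thesis
          by (simp add: cls_def derived_term_def coset_join2 subgroup_self reduce_in_carrier)
      qed
      then show "cls 0 a = cls 0 b" by simp
      have sign: "(if p then 1 else -1) = (1 :: int) \<longleftrightarrow> p" for p by simp
      assume "a \<le> b" "b \<le> length w"
      then show "cls (Suc m) a = cls (Suc m) b \<longleftrightarrow>
        (\<forall>j<length w. (\<Sum>k\<in>{a..<b}. if int (fst (w ! k)) = int (fst (w ! j)) \<and>
            cls m (if (if snd (w ! k) then 1 else - 1) = (1 :: int) then k else Suc k) =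
            cls m (if (if snd (w ! j) then 1 else - 1) = (1 :: int) then j else Suc j)
          then if snd (w ! k) then 1 else - 1 else 0) = (0 :: int))"
        unfolding sign of_nat_eq_iff cls_def by (rule derived_term_coset_Suc_iff[OF w])
    next
      fix k assume "k < length w"
      then have "w ! k \<in> set w" by simp
      then show "\<bar>int (fst (w ! k))\<bar> \<le> int r" using w by (auto simp: words_def)
    qed (use r d in auto)
    have "runs B word_problem (input_store r d w) (300 * d * (length w + 1) ^ 3)
        (\<lambda>s. vars s ''out'' = (if cls d 0 = cls d (length w) then 1 else 0))"
      using False by (intro runs_word_problem) (auto simp: base_def input_store_def)
    then obtain t s where e: "exec B word_problem (input_store r d w) t s"
      "t \<le> 300 * d * (length w + 1) ^ 3" "vars s ''out'' = ?out"
      by (auto simp: runs_def word_class_eq_one_iff cls_def)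
    have "(length w + 1) ^ 3 \<le> (2 * length w) ^ 3"
      using False by (intro power_mono) (auto simp: Suc_le_eq)
    then have "300 * d * (length w + 1) ^ 3 \<le> 300 * d * (8 * length w ^ 3)"
      by (intro mult_le_mono2) (simp add: power_mult_distrib)
    also have "\<dots> \<le> 2400 * (d * r * length w ^ 3 + 1)"
    proof -
      have "d * 1 * length w ^ 3 \<le> d * r * length w ^ 3"
        using r by (intro mult_le_mono1 mult_le_mono2) simp
      then have le: "d * length w ^ 3 \<le> d * r * length w ^ 3" by (simp only: mult_1_right)
      have eq: "300 * d * (8 * length w ^ 3) = 2400 * (d * length w ^ 3)" by simp
      show ?thesis unfolding eq by (intro mult_le_mono2 trans_le_add1 le)
    qed
    finally have "t \<le> 2400 * (d * r * length w ^ 3 + 1)" using e(2) by (rule order_trans[rotated])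
    with e(1,3) show ?thesis by (intro exI[of _ t] exI[of _ s]) simp
  qed
  then show "\<exists>t s. exec ?B word_problem (input_store r d w) t s \<and>
      t \<le> 2400 * (d * r * length w ^ 3 + 1) \<and> vars s ''out'' = ?out" .
qed

end
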